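(* For every integer $k \geq 3$, there is a constant $C=C(k)$ such that, for every convex body $K \subseteq \mathbb{R}^2$ of unit area, we have \[\lim_{n \to \infty}n^{-2}EH_{2,k}^K(n) = C.\]
   Context: A convex body in $\mathbb{R}^2$ is a compact convex subset of $\mathbb{R}^2$ with nonempty interior. A finite point set is in convex position if none of its points lies in the convex hull of the remaining points. A finite set $S\subseteq\mathbb{R}^2$ is in general position if no three of its points lie on a line. For an integer $k\ge 3$, a $k$-hole in a finite set $S\subseteq\mathbb{R}^2$ in general position is a set of $k$ points of $S$ in convex position whose convex hull contains no point of $S$ in its interior. For a convex body $K\subseteq\mathbb{R}^2$ of unit area, $EH^K_{2,k}(n)$ denotes the expected number of $k$-holes in a set of $n$ points chosen uniformly and independently at random from $K$ (such a set is in general position with probability $1$). The constant $C(k)$ depends only on $k$ (not on $K$), and the claim includes the existence of the limit. *)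

theory Defs
  imports "HOL-Probability.Probability"
begin

definition convex_body :: "(real^2) set \<Rightarrow> bool" where
  "convex_body K \<longleftrightarrow> compact K \<and> convex K \<and> interior K \<noteq> {}"

definition convex_position :: "(real^2) set \<Rightarrow> bool" where
  "convex_position T \<longleftrightarrow> finite T \<and> (\<forall>x\<in>T. x \<notin> convex hull (T - {x}))"

definition general_position :: "(real^2) set \<Rightarrow> bool" where
  "general_position S \<longleftrightarrow> (\<forall>T\<subseteq>S. card T = 3 \<longrightarrow> \<not> collinear T)"

text \<open>Holes are defined only for finite sets in general position; all other sets have no holes
  here. For random points from a convex body this convention concerns a null set only.\<close>

definition is_hole :: "nat \<Rightarrow> (real^2) set \<Rightarrow> (real^2) set \<Rightarrow> bool" where
  "is_hole k S H \<longleftrightarrow>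
     finite S \<and> general_position S \<and>
     H \<subseteq> S \<and> card H = k \<and> convex_position H \<and> interior (convex hull H) \<inter> S = {}"

definition num_holes :: "nat \<Rightarrow> (real^2) set \<Rightarrow> nat" where
  "num_holes k S = card {H. is_hole k S H}"

text \<open>The expectation is over \<open>n\<close> independent points \<open>X 0, \<dots>, X (n - 1)\<close>, each uniform on \<open>K\<close>.\<close>

definition EH :: "(real^2) set \<Rightarrow> nat \<Rightarrow> nat \<Rightarrow> real" where
  "EH K k n =
     integral\<^sup>L (Pi\<^sub>M {..<n} (\<lambda>_. uniform_measure lborel K)) (\<lambda>X. real (num_holes k (X ` {..<n})))"

end

theory Submission
  imports Defs
begin

text \<open>By linearity and symmetry the expected number of holes is \<open>n choose k\<close> times the integral over
  \<open>k\<close>-tuples of \<open>K\<close> in convex position of \<open>(1 - A)\<^sup>n\<^sup>-\<^sup>k\<close>, where \<open>A\<close> is the area of the hull. Almost surely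
  exactly one pair \<open>p\<close>, \<open>q\<close> of the \<open>k\<close> points bounds a vertical strip containing all of them. With
  \<open>w\<close> the horizontal distance of \<open>p\<close> and \<open>q\<close>, write each other point as \<open>p + t (q - p) + (0, u / (n w))\<close>.
  This affine substitution has Jacobian \<open>1 / n\<close>, maps the hull of \<open>0\<close>, \<open>(1, 0)\<close> and the points
  \<open>(t, u)\<close> to the hull of the given points, so that \<open>A = a / n\<close> with \<open>a\<close> independent of \<open>p\<close>, \<open>q\<close>, and preserves
  convex position. For interior \<open>p\<close>, \<open>q\<close> the condition that all points lie in \<open>K\<close> disappears in the limit
  and \<open>(1 - a / n)\<^sup>n\<^sup>-\<^sup>k\<close> tends to \<open>exp (- a)\<close>. Since \<open>a\<close> is at least half of every \<open>\<bar>u\<bar>\<close>, dominated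
  convergence applies, and integrating over \<open>p\<close> and \<open>q\<close> only contributes a factor 1.\<close>

section \<open>Measurability of convex hulls of random points\<close>


text \<open>Phrased for indexed families, so that it is an event on a product space. A repeated
  value lies in the hull of the other points, so the condition forces injectivity.\<close>

definition indexed_convex_position :: "'i set \<Rightarrow> ('i \<Rightarrow> real^2) \<Rightarrow> bool" where
  "indexed_convex_position I X \<longleftrightarrow> (\<forall>i\<in>I. X i \<notin> convex hull (X ` (I - {i})))"

definition hull_area :: "'i set \<Rightarrow> ('i \<Rightarrow> real^2) \<Rightarrow> real" where
  "hull_area I X = measure lborel (convex hull (X ` I))"

text \<open>A strict separation survives a small change of the separating vector, so this vector can
  be taken from a dense set. With a countable dense set, membership in a random hull becomes a
  countable combination of linear inequalities, hence measurable.\<close>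

lemma notin_convex_hull_iff_dense:
  fixes x :: "'a::euclidean_space"
  assumes F: "finite F" and D: "\<And>U. open U \<Longrightarrow> U \<noteq> {} \<Longrightarrow> \<exists>d\<in>D. d \<in> (U::'a set)"
  shows "x \<notin> convex hull F \<longleftrightarrow> (\<exists>a\<in>D. \<forall>f\<in>F. a \<bullet> f < a \<bullet> x)"
proof
  assume x: "x \<notin> convex hull F"
  have "closed (convex hull F)"
    using F by (simp add: compact_imp_closed finite_imp_compact_convex_hull)
  then obtain a b where ab: "a \<bullet> x < b" "\<forall>y\<in>convex hull F. b < a \<bullet> y"
    using separating_hyperplane_closed_point[of "convex hull F" x] x by auto
  define U where "U = (\<Inter>f\<in>F. {a. a \<bullet> f < a \<bullet> x})"
  have "open U" unfolding U_def using F
    by (intro open_INT ballI open_Collect_less continuous_intros) auto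
  moreover have "- a \<in> U"
    unfolding U_def using ab hull_subset[of F convex] by fastforce
  ultimately obtain d where "d \<in> D" "d \<in> U" using D by blast
  then show "\<exists>a\<in>D. \<forall>f\<in>F. a \<bullet> f < a \<bullet> x" unfolding U_def by blast
next
  assume "\<exists>a\<in>D. \<forall>f\<in>F. a \<bullet> f < a \<bullet> x"
  then obtain a where a: "\<forall>f\<in>F. a \<bullet> f < a \<bullet> x" by blast
  have "convex hull F \<subseteq> {y. a \<bullet> y < a \<bullet> x}"
    using a by (intro hull_minimal convex_halfspace_lt) auto
  then show "x \<notin> convex hull F" by auto
qed

text \<open>If a ball around \<open>x\<close> left the closed set \<open>S\<close>, the part outside
  would be open and nonempty, so it would contain some \<open>x + d\<close> with \<open>d\<close> in
  the dense set. The radii \<open>1 / Suc n\<close> keep the quantifiers countable.\<close>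

lemma interior_closed_iff_dense:
  fixes x :: "'a::euclidean_space"
  assumes S: "closed S" and D: "\<And>U. open U \<Longrightarrow> U \<noteq> {} \<Longrightarrow> \<exists>d\<in>D. d \<in> (U::'a set)"
  shows "x \<in> interior S \<longleftrightarrow> (\<exists>n::nat. \<forall>d\<in>D. norm d < 1 / Suc n \<longrightarrow> x + d \<in> S)"
proof
  assume "x \<in> interior S"
  then obtain e where e: "e > 0" "ball x e \<subseteq> S" by (auto simp: mem_interior)
  obtain n where n: "1 / Suc n < e" using e nat_approx_posE by blast
  show "\<exists>n::nat. \<forall>d\<in>D. norm d < 1 / Suc n \<longrightarrow> x + d \<in> S"
    using n e by (intro exI[of _ n]) (force simp: dist_norm)
next
  assume "\<exists>n::nat. \<forall>d\<in>D. norm d < 1 / Suc n \<longrightarrow> x + d \<in> S"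
  then obtain n where n: "\<And>d. d \<in> D \<Longrightarrow> norm d < 1 / Suc n \<Longrightarrow> x + d \<in> S" by blast
  have "ball x (1 / Suc n) \<subseteq> S"
  proof (rule ccontr)
    assume "\<not> ball x (1 / Suc n) \<subseteq> S"
    then obtain y where y: "y \<in> ball x (1 / Suc n)" "y \<notin> S" by blast
    define U where "U = (\<lambda>d. x + d) -` (ball x (1 / Suc n) - S)"
    have "open U" unfolding U_def using S
      by (intro open_vimage continuous_intros open_Diff) auto
    moreover have "y - x \<in> U" using y by (auto simp: U_def)
    ultimately obtain d where "d \<in> D" "d \<in> U" using D by blast
    then show False using n[of d] by (auto simp: U_def dist_norm)
  qed
  then show "x \<in> interior S" by (meson mem_interior of_nat_0_less_iff zero_less_Suc divide_pos_pos zero_less_one)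
qed

lemma pred_countable_Ball:
  assumes "countable D" "\<And>d. d \<in> D \<Longrightarrow> Measurable.pred M (P d)"
  shows "Measurable.pred M (\<lambda>\<omega>. \<forall>d\<in>D. P d \<omega>)"
  using sets.sets_Collect_countable_All'[of D M P] assms by (simp add: pred_def)

lemma pred_in_convex_hull:
  fixes g :: "'m \<Rightarrow> 'a::euclidean_space"
  assumes J: "finite J" and f: "\<And>j. j \<in> J \<Longrightarrow> (\<lambda>\<omega>. X \<omega> j) \<in> borel_measurable M"
    and g: "g \<in> borel_measurable M"
  shows "Measurable.pred M (\<lambda>\<omega>. g \<omega> \<in> convex hull (X \<omega> ` J))"
proof -
  obtain D :: "'a set" where D: "countable D"
    "\<And>U. open U \<Longrightarrow> U \<noteq> {} \<Longrightarrow> \<exists>d\<in>D. d \<in> U"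
    using countable_dense_setE by blast
  have "(g \<omega> \<in> convex hull (X \<omega> ` J)) \<longleftrightarrow> (\<forall>a\<in>D. \<exists>j\<in>J. \<not> a \<bullet> X \<omega> j < a \<bullet> g \<omega>)" for \<omega>
    using notin_convex_hull_iff_dense[OF finite_imageI[OF J] D(2), of "g \<omega>" "X \<omega>"] by auto
  moreover have "Measurable.pred M (\<lambda>\<omega>. \<forall>a\<in>D. \<exists>j\<in>J. \<not> a \<bullet> X \<omega> j < a \<bullet> g \<omega>)"
    by (intro pred_countable_Ball pred_intros_finite pred_intros_logic D J
        borel_measurable_pred_less borel_measurable_inner f g borel_measurable_const)
  ultimately show ?thesis by simp
qed

lemma pred_in_interior_convex_hull:
  fixes g :: "'m \<Rightarrow> 'a::euclidean_space"
  assumes J: "finite J" and f: "\<And>j. j \<in> J \<Longrightarrow> (\<lambda>\<omega>. X \<omega> j) \<in> borel_measurable M"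
    and g: "g \<in> borel_measurable M"
  shows "Measurable.pred M (\<lambda>\<omega>. g \<omega> \<in> interior (convex hull (X \<omega> ` J)))"
proof -
  obtain D :: "'a set" where D: "countable D"
    "\<And>U. open U \<Longrightarrow> U \<noteq> {} \<Longrightarrow> \<exists>d\<in>D. d \<in> U"
    using countable_dense_setE by blast
  have cl: "closed (convex hull (X \<omega> ` J))" for \<omega>
    using J by (simp add: compact_imp_closed finite_imp_compact_convex_hull)
  have "Measurable.pred M (\<lambda>\<omega>. \<exists>n::nat. \<forall>d\<in>D. norm d < 1 / Suc n \<longrightarrow>
           g \<omega> + d \<in> convex hull (X \<omega> ` J))"
    by (intro pred_intros_countable(2) pred_countable_Ball pred_intros_logic D J
        pred_in_convex_hull borel_measurable_add borel_measurable_const f g measurable_const) simp_all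
  then show ?thesis by (simp add: interior_closed_iff_dense[OF cl D(2)])
qed

lemma pred_indexed_convex_position:
  assumes I: "finite I" and f: "\<And>i. i \<in> I \<Longrightarrow> (\<lambda>\<omega>. X \<omega> i) \<in> borel_measurable M"
  shows "Measurable.pred M (\<lambda>\<omega>. indexed_convex_position I (X \<omega>))"
  unfolding indexed_convex_position_def
  by (intro pred_intros_finite pred_intros_logic I pred_in_convex_hull f finite_Diff) auto

text \<open>The area is the measure of a section of the set of pairs of an outcome and a point of
  its hull. This set is measurable in the product, and measures of sections are measurable
  functions.\<close>

lemma borel_measurable_hull_area:
  assumes I: "finite I" and f: "\<And>i. i \<in> I \<Longrightarrow> (\<lambda>\<omega>. X \<omega> i) \<in> borel_measurable M"
  shows "(\<lambda>\<omega>. hull_area I (X \<omega>)) \<in> borel_measurable M"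
proof -
  define Q where "Q = {z \<in> space (M \<Otimes>\<^sub>M (lborel :: (real^2) measure)). snd z \<in> convex hull (X (fst z) ` I)}"
  have "Measurable.pred (M \<Otimes>\<^sub>M (lborel :: (real^2) measure)) (\<lambda>z. snd z \<in> convex hull (X (fst z) ` I))"
    by (rule pred_in_convex_hull[OF I]) (auto intro: measurable_compose[OF measurable_fst f])
  then have Q: "Q \<in> sets (M \<Otimes>\<^sub>M (lborel :: (real^2) measure))"
    unfolding Q_def by (simp add: pred_def)
  have "(\<lambda>\<omega>. enn2real (emeasure lborel (Pair \<omega> -` Q))) \<in> borel_measurable M"
    by (intro borel_measurable_enn2real lborel.measurable_emeasure_Pair Q)
  also have "?this \<longleftrightarrow> ?thesis"
    unfolding hull_area_def measure_def
    by (rule measurable_cong) (auto simp: Q_def space_pair_measure vimage_def)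
  finally show ?thesis .
qed

lemma indexed_convex_position_iff:
  assumes "finite I"
  shows "indexed_convex_position I X \<longleftrightarrow> inj_on X I \<and> convex_position (X ` I)"
proof
  assume *: "indexed_convex_position I X"
  have inj: "inj_on X I"
  proof (rule inj_onI, rule ccontr)
    fix i j assume "i \<in> I" "j \<in> I" "X i = X j" "i \<noteq> j"
    then have "X i \<in> X ` (I - {i})" by auto
    then have "X i \<in> convex hull (X ` (I - {i}))" by (rule hull_inc)
    then show False using * \<open>i \<in> I\<close> by (simp add: indexed_convex_position_def)
  qed
  have diff: "X ` I - {X i} = X ` (I - {i})" if "i \<in> I" for i
    using inj_on_image_set_diff[OF inj, of I "{i}"] that by simp
  then show "inj_on X I \<and> convex_position (X ` I)"
    using inj * assms diff by (simp add: convex_position_def indexed_convex_position_def)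
next
  assume *: "inj_on X I \<and> convex_position (X ` I)"
  then have inj: "inj_on X I" by simp
  have diff: "X ` I - {X i} = X ` (I - {i})" if "i \<in> I" for i
    using inj_on_image_set_diff[OF inj, of I "{i}"] that by simp
  then show "indexed_convex_position I X"
    using * diff by (simp add: convex_position_def indexed_convex_position_def)
qed

text \<open>The points of \<open>H\<close> are extreme points of their hull, and an extreme point is
  not interior. Thus only points outside \<open>H\<close> can spoil a hole.\<close>

lemma convex_position_notin_interior:
  assumes "convex_position H" "x \<in> H"
  shows "x \<notin> interior (convex hull H)"
proof -
  have "x extreme_point_of (convex hull (insert x (H - {x})))"
    using assms by (intro extreme_point_of_convex_hull_insert) (auto simp: convex_position_def)
  then show ?thesis
    using assms by (simp add: insert_absorb extreme_point_not_in_interior)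
qed

lemma indexed_convex_position_image:
  assumes "inj h" "\<And>S. convex hull (h ` S) = h ` (convex hull S)"
  shows "indexed_convex_position I (\<lambda>i. h (X i)) \<longleftrightarrow> indexed_convex_position I X"
proof -
  have "(\<lambda>i. h (X i)) ` J = h ` (X ` J)" for J by (simp add: image_image)
  then show ?thesis
    unfolding indexed_convex_position_def by (simp add: assms(2) inj_image_mem_iff[OF assms(1)])
qed


section \<open>Change of variables in product measures\<close>

lemma PiM_transform:
  assumes R: "finite R" and sf: "sigma_finite_measure M" "sigma_finite_measure N"
    and g[measurable]: "g \<in> borel_measurable M" and T[measurable]: "T \<in> measurable M N"
    and eq: "\<And>A. A \<in> sets N \<Longrightarrow> emeasure N A = (\<integral>\<^sup>+y. g y * indicator A (T y) \<partial>M)"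
  shows "Pi\<^sub>M R (\<lambda>_. N) =
    distr (density (Pi\<^sub>M R (\<lambda>_. M)) (\<lambda>y. \<Prod>r\<in>R. g (y r))) (Pi\<^sub>M R (\<lambda>_. N)) (\<lambda>y. \<lambda>r\<in>R. T (y r))"
    (is "_ = ?P")
proof -
  interpret M: product_sigma_finite "\<lambda>_. M" by (simp add: product_sigma_finite_def sf)
  interpret N: product_sigma_finite "\<lambda>_. N" by (simp add: product_sigma_finite_def sf)
  \<comment> \<open>A product measure is determined by its values on boxes. There the integrand is a
    product, and the integral factors into one instance of \<open>eq\<close> for each
    coordinate.\<close>
  have "?P = Pi\<^sub>M R (\<lambda>_. N)"
  proof (rule N.PiM_eqI[OF R])
    fix A assume A: "\<And>i. i \<in> R \<Longrightarrow> A i \<in> sets N"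
    then have [measurable]: "i \<in> R \<Longrightarrow> A i \<in> sets N" for i .
    have ind: "indicator (Pi\<^sub>E R A) (\<lambda>r\<in>R. T (y r)) = (\<Prod>r\<in>R. indicator (A r) (T (y r)) :: ennreal)"
      for y
    proof (cases "\<forall>r\<in>R. T (y r) \<in> A r")
      case False
      then show ?thesis using R by (auto simp: indicator_def prod_zero_iff PiE_iff)
    qed (auto simp: PiE_iff)
    have "emeasure ?P (Pi\<^sub>E R A) =
        (\<integral>\<^sup>+x. indicator (Pi\<^sub>E R A) x \<partial>?P)"
      using A R by simp
    also have "\<dots> = (\<integral>\<^sup>+y. (\<Prod>r\<in>R. g (y r)) * indicator (Pi\<^sub>E R A) (\<lambda>r\<in>R. T (y r)) \<partial>Pi\<^sub>M R (\<lambda>_. M))"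
      using A R by (subst nn_integral_distr) (auto simp: nn_integral_density)
    also have "\<dots> = (\<integral>\<^sup>+y. (\<Prod>r\<in>R. g (y r) * indicator (A r) (T (y r))) \<partial>Pi\<^sub>M R (\<lambda>_. M))"
      by (simp add: ind prod.distrib)
    also have "\<dots> = (\<Prod>r\<in>R. \<integral>\<^sup>+y. g y * indicator (A r) (T y) \<partial>M)"
      using A by (intro M.product_nn_integral_prod R) measurable
    also have "\<dots> = (\<Prod>r\<in>R. emeasure N (A r))"
      using A by (intro prod.cong refl) (simp add: eq)
    finally show "emeasure ?P (Pi\<^sub>E R A) = (\<Prod>r\<in>R. emeasure N (A r))" .
  qed simp
  then show ?thesis by simp
qed

lemma nn_integral_PiM_transform:
  assumes R: "finite R" and sf: "sigma_finite_measure M" "sigma_finite_measure N"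
    and g[measurable]: "g \<in> borel_measurable M" and T[measurable]: "T \<in> measurable M N"
    and eq: "\<And>A. A \<in> sets N \<Longrightarrow> emeasure N A = (\<integral>\<^sup>+y. g y * indicator A (T y) \<partial>M)"
    and F[measurable]: "F \<in> borel_measurable (Pi\<^sub>M R (\<lambda>_. N))"
  shows "(\<integral>\<^sup>+x. F x \<partial>Pi\<^sub>M R (\<lambda>_. N)) =
    (\<integral>\<^sup>+y. (\<Prod>r\<in>R. g (y r)) * F (\<lambda>r\<in>R. T (y r)) \<partial>Pi\<^sub>M R (\<lambda>_. M))"
  by (subst PiM_transform[OF R sf g T eq])
     (auto simp: nn_integral_distr nn_integral_density R)

section \<open>The affine substitution\<close>

text \<open>The affine substitution: it takes \<open>0\<close> to \<open>p\<close> and the first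
  unit vector to \<open>q\<close>, and keeps vertical directions vertical. Its determinant is
  \<open>c * (q $ 1 - p $ 1)\<close>; the free factor \<open>c\<close> is later chosen to make this
  \<open>1 / n\<close>.\<close>

definition shear :: "real^2 \<Rightarrow> real^2 \<Rightarrow> real \<Rightarrow> real^2 \<Rightarrow> real^2" where
  "shear p q c y = p + (y $ 1 *\<^sub>R (q - p) + (c * y $ 2) *\<^sub>R axis 2 1)"

lemma shear_nth:
  fixes p q y :: "real^2"
  shows "shear p q c y $ 1 = p $ 1 + y $ 1 * (q $ 1 - p $ 1)"
  "shear p q c y $ 2 = p $ 2 + y $ 1 * (q $ 2 - p $ 2) + c * y $ 2"
  by (simp_all add: shear_def axis_def)

lemma shear_0: "shear p q c 0 = p" and shear_axis: "shear p q c (axis 1 1) = q"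
  by (simp_all add: shear_def axis_def)

lemma continuous_on_shear: "continuous_on UNIV (shear p q c)"
  unfolding shear_def[abs_def] by (intro continuous_intros)

lemma measurable_shear[measurable]: "shear p q c \<in> borel_measurable borel"
  by (intro borel_measurable_continuous_onI continuous_on_shear)

lemma linear_shear_part: "linear (\<lambda>y::real^2. y $ 1 *\<^sub>R (q - p :: real^2) + (c * y $ 2) *\<^sub>R axis 2 1)"
  by (rule linearI) (simp_all add: algebra_simps)

lemma shear_image: "shear p q c ` S =
    (+) p ` (\<lambda>y. y $ 1 *\<^sub>R (q - p) + (c * y $ 2) *\<^sub>R axis 2 1) ` S"
  by (simp add: shear_def image_image)

lemma convex_hull_shear: "convex hull (shear p q c ` S) = shear p q c ` (convex hull S)"
  unfolding shear_image by (simp add: convex_hull_translation convex_hull_linear_image linear_shear_part)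

lemma inj_shear:
  assumes "c \<noteq> 0" "q $ 1 \<noteq> p $ 1"
  shows "inj (shear p q c)"
proof (rule injI)
  fix x y :: "real^2" assume *: "shear p q c x = shear p q c y"
  have "x $ 1 = y $ 1" using arg_cong[OF *, of "\<lambda>v. v $ 1"] assms by (simp add: shear_nth)
  moreover from this have "x $ 2 = y $ 2"
    using arg_cong[OF *, of "\<lambda>v. v $ 2"] assms by (simp add: shear_nth)
  ultimately show "x = y" by (simp add: vec_eq_iff forall_2)
qed

lemma surj_shear:
  assumes "c \<noteq> 0" "q $ 1 \<noteq> p $ 1"
  shows "surj (shear p q c)"
proof (rule surjI)
  fix x :: "real^2"
  let ?t = "(x $ 1 - p $ 1) / (q $ 1 - p $ 1)"
  show "shear p q c (vector [?t, (x $ 2 - p $ 2 - ?t * (q $ 2 - p $ 2)) / c]) = x"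
    using assms by (simp add: vec_eq_iff forall_2 shear_nth)
qed

lemma measure_shear_image:
  assumes S: "S \<in> lmeasurable"
  shows "shear p q c ` S \<in> lmeasurable" 
    "measure lebesgue (shear p q c ` S) = \<bar>c * (q $ 1 - p $ 1)\<bar> * measure lebesgue S"
proof -
  let ?L = "\<lambda>y::real^2. y $ 1 *\<^sub>R (q - p) + (c * y $ 2) *\<^sub>R axis 2 1"
  have "det (matrix ?L) = c * (q $ 1 - p $ 1)"
    by (simp add: det_2 matrix_def axis_def)
  then have "measure lebesgue (?L ` S) = \<bar>c * (q $ 1 - p $ 1)\<bar> * measure lebesgue S"
    using measure_linear_image[OF linear_shear_part S] by simp
  then show "measure lebesgue (shear p q c ` S) = \<bar>c * (q $ 1 - p $ 1)\<bar> * measure lebesgue S"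
    unfolding shear_image by (simp add: measure_translation)
  show "shear p q c ` S \<in> lmeasurable"
    unfolding shear_image
    by (intro measurable_translation measurable_linear_image linear_shear_part S)
qed

text \<open>It is enough to compare open boxes. The preimage of a box is open and bounded, and its
  image is the box by surjectivity, so the determinant formula for images applies.\<close>

lemma lborel_shear:
  assumes "c \<noteq> 0" "q $ 1 \<noteq> p $ 1"
  shows "lborel = density (distr lborel borel (shear p q c)) (\<lambda>_. ennreal \<bar>c * (q $ 1 - p $ 1)\<bar>)"
    (is "_ = ?M")
proof (rule lborel_eqI)
  define d where "d = \<bar>c * (q $ 1 - p $ 1)\<bar>"
  have d: "d > 0" using assms by (simp add: d_def)
  fix l u :: "real^2"
  assume lu: "\<And>b. b \<in> Basis \<Longrightarrow> l \<bullet> b \<le> u \<bullet> b"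
  let ?B = "box l u" and ?h = "shear p q c"
  have im: "?h ` (?h -` ?B) = ?B" using surj_shear[OF assms] by (rule surj_image_vimage_eq)
  have op: "open (?h -` ?B)" by (intro open_vimage continuous_on_shear) auto
  \<comment> \<open>The explicit inverse \<open>g\<close> is continuous, so the preimage lies in the
    compact image of a closed box.\<close>
  have bd: "bounded (?h -` ?B)"
  proof -
    define t where "t x = (x $ 1 - p $ 1) / (q $ 1 - p $ 1)" for x :: "real^2"
    define g :: "real^2 \<Rightarrow> real^2" where
      "g x = t x *\<^sub>R axis 1 1 + ((x $ 2 - p $ 2 - t x * (q $ 2 - p $ 2)) / c) *\<^sub>R axis 2 1" for x
    have "compact (g ` cbox l u)"
      unfolding g_def[abs_def] t_def[abs_def] using assms
      by (intro compact_continuous_image continuous_intros) auto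
    moreover have "g (?h y) = y" for y
      using assms by (simp add: vec_eq_iff forall_2 g_def t_def shear_nth axis_def)
    then have "?h -` ?B \<subseteq> g ` cbox l u"
      using box_subset_cbox by (metis (no_types, lifting) imageI subsetI subset_iff vimageD)
    ultimately show ?thesis using bounded_subset compact_imp_bounded by blast
  qed
  have lm: "?h -` ?B \<in> lmeasurable" using op bd by (simp add: lmeasurable_open)
  have "emeasure ?M ?B = ennreal d * emeasure lborel (?h -` ?B)"
    by (simp add: emeasure_density emeasure_distr d_def nn_integral_cmult_indicator)
  also have "emeasure lborel (?h -` ?B) = ennreal (measure lebesgue (?h -` ?B))"
    using emeasure_eq_measure2[OF lm] op by simp
  also have "ennreal d * \<dots> = ennreal (measure lebesgue ?B)"
    using measure_shear_image(2)[OF lm, of p q c] by (simp add: im d_def ennreal_mult del: image_vimage_eq)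
  also have "\<dots> = (\<Prod>b\<in>Basis. (u - l) \<bullet> b)"
    using lu by (simp add: measure_lborel_box_eq)
  finally show "emeasure ?M ?B = (\<Prod>b\<in>Basis. (u - l) \<bullet> b)" .
qed simp


text \<open>The restriction to \<open>K\<close> is absorbed into the density, which gives the
  equation in the form that \<open>nn_integral_PiM_transform\<close> asks for.\<close>

lemma emeasure_uniform_shear:
  assumes c: "c \<noteq> 0" "q $ 1 \<noteq> p $ 1"
    and K: "K \<in> sets borel" "emeasure lborel K = 1" and A: "A \<in> sets borel"
  shows "emeasure (uniform_measure lborel K) A =
    (\<integral>\<^sup>+y. (ennreal \<bar>c * (q $ 1 - p $ 1)\<bar> * indicator K (shear p q c y)) *
      indicator A (shear p q c y) \<partial>lborel)"
proof -
  have [measurable]: "K \<in> sets borel" "A \<in> sets borel" by fact+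
  have "emeasure (uniform_measure lborel K) A = emeasure lborel (K \<inter> A)"
    using K A by (simp add: emeasure_uniform_measure divide_ennreal_def)
  also have "\<dots> = (\<integral>\<^sup>+x. indicator (K \<inter> A) x \<partial>lborel)"
    using K A by simp
  also have "\<dots> = (\<integral>\<^sup>+y. ennreal \<bar>c * (q $ 1 - p $ 1)\<bar> * indicator (K \<inter> A) (shear p q c y) \<partial>lborel)"
    by (subst (1) lborel_shear[OF c])
      (simp add: nn_integral_density nn_integral_distr del: nn_integral_indicator nn_integral_indicator')
  finally show ?thesis by (simp add: indicator_inter_arith mult.assoc)
qed

lemma compact_convex_hull_image: "finite I \<Longrightarrow> compact (convex hull ((X :: 'i \<Rightarrow> real^2) ` I))"
  by (simp add: finite_imp_compact_convex_hull)

lemma hull_area_shear: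
  assumes "finite I"
  shows "hull_area I (\<lambda>i. shear p q c (X i)) = \<bar>c * (q $ 1 - p $ 1)\<bar> * hull_area I X"
proof -
  have leb: "hull_area I Y = measure lebesgue (convex hull (Y ` I))" for Y
    unfolding hull_area_def using compact_convex_hull_image[OF assms, of Y] 
    by (simp add: borel_compact)
  have im: "(\<lambda>i. shear p q c (X i)) ` I = shear p q c ` X ` I" by (simp add: image_image)
  show ?thesis
    unfolding leb im convex_hull_shear
    using measure_shear_image(2) lmeasurable_compact compact_convex_hull_image[OF assms] by blast
qed

text \<open>The hull contains the triangle with unit base from \<open>0\<close> to
  \<open>axis 1 1\<close> and apex \<open>X r\<close>. Large second coordinates therefore force a
  large area, which later gives exponential decay.\<close>

lemma hull_area_ge_height:
  assumes I: "finite I" "i \<in> I" "j \<in> I" "r \<in> I" and X: "X i = 0" "X j = axis 1 1"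
  shows "\<bar>X r $ 2\<bar> / 2 \<le> hull_area I X"
proof -
  have "\<bar>X r $ 2\<bar> / 2 = measure lborel (convex hull {0, axis 1 1, X r})"
    by (subst content_triangle) (simp add: axis_def)
  also have "\<dots> \<le> measure lborel (convex hull (X ` I))"
  proof (rule measure_mono_fmeasurable)
    show "convex hull {0, axis 1 1, X r} \<subseteq> convex hull (X ` I)"
      using I X by (intro hull_mono) (auto simp: image_iff, metis+)
    show "convex hull (X ` I) \<in> fmeasurable lborel"
      using compact_convex_hull_image[OF I(1), of X] emeasure_bounded_finite[OF compact_imp_bounded]
      by (auto simp: fmeasurable_def borel_compact)
    show "convex hull {0, axis 1 1, X r} \<in> sets lborel"
      by (simp add: borel_compact finite_imp_compact_convex_hull)
  qed
  finally show ?thesis by (simp add: hull_area_def)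
qed

lemma nn_integral_exp_neg_abs_finite:
  assumes c: "(c::real) > 0"
  shows "(\<integral>\<^sup>+u. ennreal (exp (- c * \<bar>u\<bar>)) \<partial>lborel) < \<infinity>"
proof -
  have "((\<lambda>x. - (exp (- c * x) / c)) \<longlongrightarrow> - (0 / c)) at_top"
    using c by (intro tendsto_intros filterlim_compose[OF exp_at_bot])
      (auto simp: filterlim_uminus_at_bot
        intro!: filterlim_tendsto_pos_mult_at_top[OF tendsto_const] filterlim_ident)
  then have half: "(\<integral>\<^sup>+u. ennreal (exp (- c * u)) * indicator {0..} u \<partial>lborel) = ennreal (0 - (- (exp (- c * 0) / c)))"
    using c by (intro nn_integral_FTC_atLeast) (auto intro!: derivative_eq_intros)
  \<comment> \<open>The two closed half-lines share the point \<open>0\<close>, hence the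
    inequality. The negative half is the reflection of the positive one.\<close>
  have "(\<integral>\<^sup>+u. ennreal (exp (- c * \<bar>u\<bar>)) \<partial>lborel) \<le>
     (\<integral>\<^sup>+u. ennreal (exp (- c * u)) * indicator {0..} u + ennreal (exp (- c * (- u))) * indicator {0..} (-u) \<partial>lborel)"
    by (intro nn_integral_mono) (auto simp: indicator_def abs_if)
  also have "\<dots> = (\<integral>\<^sup>+u. ennreal (exp (- c * u)) * indicator {0..} u \<partial>lborel) +
      (\<integral>\<^sup>+u. ennreal (exp (- c * (- u))) * indicator {0..} (-u) \<partial>lborel)"
    by (intro nn_integral_add) auto
  also have "(\<integral>\<^sup>+u. ennreal (exp (- c * (- u))) * indicator {0..} (-u) \<partial>lborel) =
      (\<integral>\<^sup>+u. ennreal (exp (- c * u)) * indicator {0..} u \<partial>lborel)"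
    using nn_integral_real_affine[of "\<lambda>u. ennreal (exp (- c * u)) * indicator {0..} u" "-1" 0] by simp
  finally show ?thesis unfolding half by (auto simp: less_top[symmetric] top_unique)
qed

lemma nn_integral_strip_exp_finite:
  assumes c: "(c::real) > 0"
  shows "(\<integral>\<^sup>+y. indicator {0..1} ((y::real^2) $ 1) * ennreal (exp (- c * \<bar>y $ 2\<bar>)) \<partial>lborel) < \<infinity>"
proof -
  \<comment> \<open>One factor for each coordinate, indexed by the basis vectors, so that the
    integral over the plane becomes a product of two integrals over the line.\<close>
  define f where "f b = (if b = (axis 1 1 :: real^2) then indicator {0..1} else (\<lambda>u. ennreal (exp (- c * \<bar>u\<bar>))))" for b
  have ne: "axis 1 1 \<noteq> (axis 2 1 :: real^2)" by (simp add: axis_eq_axis)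
  have B: "(Basis :: (real^2) set) = {axis 1 1, axis 2 1}"
    by (auto simp: Basis_vec_def exhaust_2 UNIV_2)
  have "(\<integral>\<^sup>+y. (\<Prod>b\<in>Basis. f b (y \<bullet> b)) \<partial>lborel) = (\<Prod>b\<in>Basis. (\<integral>\<^sup>+u. f b u \<partial>lborel))"
    by (intro nn_integral_lborel_prod) (auto simp: f_def)
  also have "\<dots> = (\<integral>\<^sup>+u. indicator {0..1::real} u \<partial>lborel) * (\<integral>\<^sup>+u. ennreal (exp (- c * \<bar>u\<bar>)) \<partial>lborel)"
    using ne by (simp add: B f_def)
  also have "\<dots> < \<infinity>"
    using nn_integral_exp_neg_abs_finite[OF c] by (simp add: ennreal_mult_less_top)
  finally show ?thesis using ne by (simp add: B f_def inner_axis)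
qed


section \<open>The limit for a fixed spanning pair\<close>

text \<open>All points lie in the closed vertical strip between \<open>X i\<close> and \<open>X j\<close>.\<close>

definition spans :: "'i set \<Rightarrow> 'i \<Rightarrow> 'i \<Rightarrow> ('i \<Rightarrow> real^2) \<Rightarrow> bool" where
  "spans I i j X \<longleftrightarrow> (\<forall>r\<in>I. (X r $ 1 - X i $ 1) * (X r $ 1 - X j $ 1) \<le> 0)"

lemma borel_measurable_vec_nth [measurable]: "(\<lambda>x::real^'n. x $ l) \<in> borel_measurable borel"
  by (intro borel_measurable_continuous_onI continuous_intros)

lemma pred_spans:
  assumes I: "finite I" "i \<in> I" "j \<in> I"
    and f: "\<And>i. i \<in> I \<Longrightarrow> (\<lambda>\<omega>. X \<omega> i) \<in> borel_measurable M"
  shows "Measurable.pred M (\<lambda>\<omega>. spans I i j (X \<omega>))"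
proof -
  have [measurable]: "(\<lambda>\<omega>. X \<omega> l $ 1) \<in> borel_measurable M" if "l \<in> I" for l
    using measurable_compose[OF f[OF that] borel_measurable_vec_nth] by simp
  show ?thesis
    unfolding spans_def using I by measurable
qed

text \<open>For points of a body of unit area the power is the probability that \<open>m\<close>
  further random points miss the hull. Splitting by the spanning pair provides the two points from
  which the substitution starts.\<close>

definition hole_weight :: "'i set \<Rightarrow> 'i \<Rightarrow> 'i \<Rightarrow> nat \<Rightarrow> ('i \<Rightarrow> real^2) \<Rightarrow> ennreal" where
  "hole_weight I i j m X = indicator {X. indexed_convex_position I X \<and> spans I i j X} X *
     ennreal ((1 - hull_area I X) ^ m)"

definition limit_weight :: "'i set \<Rightarrow> 'i \<Rightarrow> 'i \<Rightarrow> ('i \<Rightarrow> real^2) \<Rightarrow> ennreal" where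
  "limit_weight I i j X = indicator {X. indexed_convex_position I X \<and> spans I i j X} X *
     ennreal (exp (- hull_area I X))"

lemma measurable_spanned_position:
  assumes I: "finite I" "i \<in> I" "j \<in> I"
    and f: "\<And>i. i \<in> I \<Longrightarrow> (\<lambda>\<omega>. X \<omega> i) \<in> borel_measurable M"
  shows "(\<lambda>\<omega>. indicator {X. indexed_convex_position I X \<and> spans I i j X} (X \<omega>) :: ennreal) \<in> borel_measurable M"
proof -
  have [measurable]: "Measurable.pred M (\<lambda>\<omega>. indexed_convex_position I (X \<omega>))"
    "Measurable.pred M (\<lambda>\<omega>. spans I i j (X \<omega>))"
    using pred_indexed_convex_position[OF I(1) f] pred_spans[OF I f] by auto
  show ?thesis unfolding indicator_def by simp
qed

lemma measurable_hole_weight: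
  assumes I: "finite I" "i \<in> I" "j \<in> I"
    and f: "\<And>i. i \<in> I \<Longrightarrow> (\<lambda>\<omega>. X \<omega> i) \<in> borel_measurable M"
  shows "(\<lambda>\<omega>. hole_weight I i j m (X \<omega>)) \<in> borel_measurable M"
proof -
  note [measurable] = measurable_spanned_position[OF I f] borel_measurable_hull_area[OF I(1) f]
  show ?thesis unfolding hole_weight_def by measurable
qed

lemma measurable_limit_weight:
  assumes I: "finite I" "i \<in> I" "j \<in> I"
    and f: "\<And>i. i \<in> I \<Longrightarrow> (\<lambda>\<omega>. X \<omega> i) \<in> borel_measurable M"
  shows "(\<lambda>\<omega>. limit_weight I i j (X \<omega>)) \<in> borel_measurable M"
proof -
  note [measurable] = measurable_spanned_position[OF I f] borel_measurable_hull_area[OF I(1) f]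
  show ?thesis unfolding limit_weight_def by measurable
qed

lemma hole_weight_cong:
  assumes "\<And>l. l \<in> I \<Longrightarrow> X l = Y l" "i \<in> I" "j \<in> I"
  shows "hole_weight I i j m X = hole_weight I i j m Y"
proof -
  have im: "X ` J = Y ` J" if "J \<subseteq> I" for J using assms that by (intro image_cong) auto
  show ?thesis
    using assms by (simp add: hole_weight_def indexed_convex_position_def spans_def hull_area_def im
        Diff_subset indicator_def cong: ball_cong)
qed

text \<open>Both factors are multiplied by \<open>q $ 1 - p $ 1\<close>, so their product changes by
  a positive square. It does not matter which of \<open>p\<close> and \<open>q\<close> is on the
  left.\<close>

lemma spans_shear:
  assumes "q $ 1 \<noteq> p $ 1" "X i = 0" "X j = axis 1 1"
  shows "spans I i j (\<lambda>l. shear p q c (X l)) \<longleftrightarrow> spans I i j X"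
proof -
  let ?w = "q $ 1 - p $ 1"
  have *: "(shear p q c (X r) $ 1 - shear p q c (X i) $ 1) * (shear p q c (X r) $ 1 - shear p q c (X j) $ 1)
      = ?w\<^sup>2 * ((X r $ 1 - X i $ 1) * (X r $ 1 - X j $ 1))" for r
    unfolding shear_nth assms by (simp add: algebra_simps power2_eq_square axis_def)
  show ?thesis
    unfolding spans_def * using assms by (simp add: mult_le_0_iff)
qed

lemma spans_normalized:
  assumes "X i = 0" "X j = axis 1 1"
  shows "spans I i j X \<longleftrightarrow> (\<forall>r\<in>I. X r $ 1 \<in> {0..1})"
  unfolding spans_def assms by (auto simp: mult_le_0_iff axis_def)

lemma tendsto_one_minus_power_diff:
  "(\<lambda>n. (1 - a / real n) ^ (n - k)) \<longlonglongrightarrow> exp (- a)"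
proof -
  \<comment> \<open>The \<open>k\<close> missing factors form a fixed power of a quantity that tends
    to \<open>1\<close>, so dividing by them does not change the limit.\<close>
  have "(\<lambda>n. (1 + (- a) / real n) ^ n / (1 - a / real n) ^ k) \<longlonglongrightarrow> exp (- a) / (1 - 0) ^ k"
    by (intro tendsto_divide tendsto_power tendsto_diff tendsto_const tendsto_exp_limit_sequentially
        tendsto_divide_0[OF tendsto_const] filterlim_real_sequentially filterlim_at_top_imp_at_infinity) auto
  moreover have "eventually (\<lambda>n. (1 + (- a) / real n) ^ n / (1 - a / real n) ^ k = (1 - a / real n) ^ (n - k)) sequentially"
  proof -
    \<comment> \<open>The bound on \<open>\<bar>a\<bar>\<close> makes the denominator nonzero, and
      \<open>k\<close> at most \<open>n\<close> keeps the subtraction of naturals exact.\<close>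
    have "eventually (\<lambda>n. n \<ge> k \<and> real n > \<bar>a\<bar>) sequentially"
      using eventually_ge_at_top filterlim_at_top_dense[THEN iffD1, OF filterlim_real_sequentially, rule_format, of "\<bar>a\<bar>"]
      by (intro eventually_conj)
    then show ?thesis
    proof eventually_elim
      case (elim n)
      then have "1 - a / real n \<noteq> 0" by (auto simp: field_simps)
      then show ?case using elim by (simp add: power_diff)
    qed
  qed
  ultimately show ?thesis by (simp add: tendsto_cong)
qed

text \<open>Since \<open>1 - x\<close> is at most \<open>exp (- x)\<close>, the exponent is
  \<open>a\<close> times \<open>(n - k) / n\<close>, and this fraction is at least
  \<open>1 / (k + 1)\<close> as soon as \<open>n\<close> exceeds \<open>k\<close>. The hypothesis
  that \<open>a\<close> is at most \<open>n\<close> keeps the base nonnegative. The bound is free of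
  \<open>n\<close>, as domination requires.\<close>

lemma one_minus_power_le_exp:
  assumes "0 \<le> a" "a \<le> real n" "k + 1 \<le> n"
  shows "(1 - a / real n) ^ (n - k) \<le> exp (- (a / (k + 1)))"
proof -
  have "(1 - a / real n) ^ (n - k) \<le> exp (- (a / n)) ^ (n - k)"
    using exp_ge_add_one_self[of "- (a / real n)"] assms by (intro power_mono) auto
  also have "\<dots> = exp (- (a * ((real n - real k) / n)))"
    using assms by (simp add: exp_of_nat_mult[symmetric] of_nat_diff mult.commute)
  also have "\<dots> \<le> exp (- (a * (1 / (k + 1))))"
  proof -
    have "real k * (k + 1) \<le> real k * n"
      using assms by (intro mult_left_mono) auto
    then have "1 / (real k + 1) \<le> (real n - real k) / n"
      using assms by (simp add: divide_simps algebra_simps)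
    then show ?thesis
      using mult_left_mono[OF _ assms(1)] by (simp add: add.commute del: times_divide_eq_right)
  qed
  finally show ?thesis by simp
qed


section \<open>Normalized configurations and the integrable bound\<close>

definition normalized :: "'i \<Rightarrow> 'i \<Rightarrow> ('i \<Rightarrow> real^2) \<Rightarrow> 'i \<Rightarrow> real^2" where
  "normalized i j y = y(i := 0, j := axis 1 1)"

lemma measurable_update2:
  fixes a b :: "'a::euclidean_space"
  assumes "l \<in> I" and N: "sets N = sets borel"
  shows "(\<lambda>y. (y(i := a, j := b)) l) \<in> borel_measurable (Pi\<^sub>M (I - {i, j}) (\<lambda>_. N))"
proof (cases "l = i \<or> l = j")
  case False
  then have "(\<lambda>y. y l) \<in> measurable (Pi\<^sub>M (I - {i, j}) (\<lambda>_. N)) N"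
    using assms by (intro measurable_component_singleton) auto
  with False show ?thesis using measurable_cong_sets[OF refl N] by auto
next
  case True
  then show ?thesis by (cases "l = j") auto
qed

text \<open>The dominating function: it depends on neither \<open>n\<close> nor the spanning pair,
  and as a product over the points it has an integral that factors.\<close>

definition strip_bound :: "'i set \<Rightarrow> real \<Rightarrow> ('i \<Rightarrow> real^2) \<Rightarrow> ennreal" where
  "strip_bound R c y = (\<Prod>r\<in>R. indicator {0..1} (y r $ 1) * ennreal (exp (- c * \<bar>y r $ 2\<bar>)))"

lemma measurable_strip_bound:
  "strip_bound R c \<in> borel_measurable (Pi\<^sub>M R (\<lambda>_. lborel))"
  unfolding strip_bound_def[abs_def] by measurable

lemma nn_integral_strip_bound_finite:
  assumes R: "finite R" and c: "c > 0"
  shows "(\<integral>\<^sup>+y. strip_bound R c y \<partial>Pi\<^sub>M R (\<lambda>_. lborel)) < \<infinity>"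
proof -
  interpret product_sigma_finite "\<lambda>_. lborel :: (real^2) measure" by standard
  have "(\<integral>\<^sup>+y. strip_bound R c y \<partial>Pi\<^sub>M R (\<lambda>_. lborel)) =
    (\<Prod>r\<in>R. \<integral>\<^sup>+y. indicator {0..1} ((y::real^2) $ 1) * ennreal (exp (- c * \<bar>y $ 2\<bar>)) \<partial>lborel)"
    unfolding strip_bound_def by (intro product_nn_integral_prod R) measurable
  also have "\<dots> < \<infinity>"
    using nn_integral_strip_exp_finite[OF c] by (simp add: power_less_top_ennreal)
  finally show ?thesis .
qed

text \<open>Neither the body nor the positions of the spanning pair occur here. This is why the
  constant depends on \<open>k\<close> alone.\<close>

definition pair_limit :: "'i set \<Rightarrow> 'i \<Rightarrow> 'i \<Rightarrow> ennreal" where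
  "pair_limit I i j =
     (\<integral>\<^sup>+y. limit_weight I i j (normalized i j y) \<partial>Pi\<^sub>M (I - {i, j}) (\<lambda>_. lborel))"

section \<open>Rescaling inside a convex body of unit area\<close>

locale unit_area_body =
  fixes K :: "(real^2) set"
  assumes K: "convex_body K" "measure lborel K = 1"
begin

abbreviation "U \<equiv> uniform_measure lborel K"

lemma K_borel: "K \<in> sets borel" and K_emeasure: "emeasure lborel K = 1"
proof -
  have "compact K" using K by (simp add: convex_body_def)
  then show "K \<in> sets borel" by (rule borel_compact)
  have "emeasure lborel K < \<infinity>"
    using \<open>compact K\<close> by (intro emeasure_bounded_finite compact_imp_bounded)
  then have "emeasure lborel K = ennreal (measure lborel K)"
    by (intro emeasure_eq_ennreal_measure) auto
  then show "emeasure lborel K = 1" using K by simp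
qed

lemma prob_space_U: "prob_space U"
  using K_emeasure by (intro prob_space_uniform_measure) auto

lemma hull_area_le_1:
  assumes I: "finite I" and X: "\<And>l. l \<in> I \<Longrightarrow> X l \<in> K"
  shows "hull_area I X \<le> 1"
proof -
  have "measure lborel (convex hull (X ` I)) \<le> measure lborel K"
  proof (rule measure_mono_fmeasurable)
    show "convex hull (X ` I) \<subseteq> K"
      using X K by (intro hull_minimal) (auto simp: convex_body_def)
    show "convex hull (X ` I) \<in> sets lborel"
      using compact_convex_hull_image[OF I] by (simp add: borel_compact)
    show "K \<in> fmeasurable lborel" using K_borel K_emeasure by (simp add: fmeasurable_def)
  qed
  then show ?thesis using K by (simp add: hull_area_def)
qed

end

locale unit_area_pair = unit_area_body K for K :: "(real^2) set" +
  fixes I :: "'i set" and i j :: 'i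
  assumes I: "finite I" "i \<in> I" "j \<in> I" "i \<noteq> j"
begin

abbreviation "R \<equiv> I - {i, j}"

text \<open>The integrand in the new coordinates, with the Jacobians already cancelled. The shear
  factor gives determinant \<open>1 / n\<close> up to sign, so the area appears divided by
  \<open>n\<close>; \<open>p\<close> and \<open>q\<close> survive only in the condition on
  \<open>K\<close>.\<close>

definition rescaled_weight :: "real^2 \<Rightarrow> real^2 \<Rightarrow> nat \<Rightarrow> ('i \<Rightarrow> real^2) \<Rightarrow> ennreal" where
  "rescaled_weight p q n y =
     (\<Prod>r\<in>R. indicator K (shear p q (1 / (real n * (q $ 1 - p $ 1))) (y r))) *
     (indicator {X. indexed_convex_position I X \<and> spans I i j X} (normalized i j y) *
     ennreal ((1 - hull_area I (normalized i j y) / n) ^ (n - card I)))"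

lemma normalized_nth: "normalized i j y i = 0" "normalized i j y j = axis 1 1"
  using I by (simp_all add: normalized_def)

lemma measurable_rescaled_weight:
  "rescaled_weight p q n \<in> borel_measurable (Pi\<^sub>M R (\<lambda>_. lborel))"
proof -
  have [measurable]: "K \<in> sets borel" by (rule K_borel)
  have f: "(\<lambda>y. normalized i j y l) \<in> borel_measurable (Pi\<^sub>M R (\<lambda>_. lborel))" if "l \<in> I" for l
    unfolding normalized_def by (rule measurable_update2[OF that]) simp
  note [measurable] = measurable_spanned_position[OF I(1-3) f] borel_measurable_hull_area[OF I(1) f]
  show ?thesis unfolding rescaled_weight_def[abs_def] by measurable
qed

text \<open>Each of the \<open>card R\<close> free points contributes a Jacobian
  \<open>1 / n\<close>, and the prefactor cancels them. Convex position and spanning are unchanged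
  by the shear.\<close>

lemma nn_integral_rescale:
  assumes pq: "p $ 1 \<noteq> q $ 1" and n: "n \<ge> 1"
  shows "ennreal (real n ^ card R) *
      (\<integral>\<^sup>+x. hole_weight I i j (n - card I) (x(i := p, j := q)) \<partial>Pi\<^sub>M R (\<lambda>_. U)) =
    (\<integral>\<^sup>+y. rescaled_weight p q n y \<partial>Pi\<^sub>M R (\<lambda>_. lborel))"
proof -
  interpret U: prob_space U by (rule prob_space_U)
  define c where "c = 1 / (real n * (q $ 1 - p $ 1))"
  have c: "c \<noteq> 0" "q $ 1 \<noteq> p $ 1" and cw: "\<bar>c * (q $ 1 - p $ 1)\<bar> = 1 / n"
    using pq n by (auto simp: c_def abs_mult)
  have Kb[measurable]: "K \<in> sets borel" by (rule K_borel)
  define F where "F x = hole_weight I i j (n - card I) (x(i := p, j := q))" for x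
  have F: "F \<in> borel_measurable (Pi\<^sub>M R (\<lambda>_. U))"
    unfolding F_def[abs_def] by (intro measurable_hole_weight I measurable_update2) auto
  have Fm: "F (\<lambda>r\<in>R. shear p q c (y r)) =
      indicator {X. indexed_convex_position I X \<and> spans I i j X} (normalized i j y) *
      ennreal ((1 - hull_area I (normalized i j y) / n) ^ (n - card I))" for y
  proof -
    \<comment> \<open>Since the shear takes \<open>0\<close> to \<open>p\<close> and
      \<open>axis 1 1\<close> to \<open>q\<close>, the tuple with \<open>p\<close> and
      \<open>q\<close> inserted is the sheared normalized tuple.\<close>
    have "F (\<lambda>r\<in>R. shear p q c (y r)) = hole_weight I i j (n - card I) (\<lambda>l. shear p q c (normalized i j y l))"
      unfolding F_def using I
      by (intro hole_weight_cong) (auto simp: normalized_def shear_0 shear_axis)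
    also have "\<dots> = indicator {X. indexed_convex_position I X \<and> spans I i j X} (normalized i j y) *
      ennreal ((1 - hull_area I (normalized i j y) / n) ^ (n - card I))"
      unfolding hole_weight_def
      using indexed_convex_position_image[OF inj_shear[OF c] convex_hull_shear, of I "normalized i j y"]
        spans_shear[where X = "normalized i j y" and i = i and j = j, OF c(2) normalized_nth]
      by (simp add: hull_area_shear[OF I(1)] cw indicator_def)
    finally show ?thesis .
  qed
  have "(\<integral>\<^sup>+x. F x \<partial>Pi\<^sub>M R (\<lambda>_. U)) =
     (\<integral>\<^sup>+y. (\<Prod>r\<in>R. ennreal \<bar>c * (q $ 1 - p $ 1)\<bar> * indicator K (shear p q c (y r))) *
        F (\<lambda>r\<in>R. shear p q c (y r)) \<partial>Pi\<^sub>M R (\<lambda>_. lborel))"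
    using I by (intro nn_integral_PiM_transform[OF _ _ _ _ _ _ F]
        emeasure_uniform_shear[OF c K_borel K_emeasure] sigma_finite_lborel U.sigma_finite_measure_axioms)
      auto
  also have "\<dots> = (\<integral>\<^sup>+y. ennreal (1 / n) ^ card R * rescaled_weight p q n y \<partial>Pi\<^sub>M R (\<lambda>_. lborel))"
    unfolding Fm cw by (simp add: prod.distrib rescaled_weight_def c_def mult.assoc)
  also have "\<dots> = ennreal (1 / n) ^ card R * (\<integral>\<^sup>+y. rescaled_weight p q n y \<partial>Pi\<^sub>M R (\<lambda>_. lborel))"
    using measurable_rescaled_weight by (rule nn_integral_cmult)
  finally have eq: "(\<integral>\<^sup>+x. F x \<partial>Pi\<^sub>M R (\<lambda>_. U)) =
      ennreal (1 / n) ^ card R * (\<integral>\<^sup>+y. rescaled_weight p q n y \<partial>Pi\<^sub>M R (\<lambda>_. lborel))" .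
  have "ennreal (real n ^ card R) * ennreal (1 / n) ^ card R = 1"
    using n by (simp add: ennreal_power[symmetric] ennreal_mult[symmetric] power_mult_distrib[symmetric]
        power_divide flip: ennreal_power)
  then show ?thesis
    unfolding F_def[symmetric] eq by (simp add: mult.assoc[symmetric])
qed

text \<open>Where the weight is nonzero, the sheared points lie in \<open>K\<close>, so the
  normalized area is at most \<open>n\<close> and the power is bounded by an exponential. In the
  rate, \<open>card I + 1\<close> comes from that bound, \<open>2\<close> from the triangle with
  apex at a free point, and the last \<open>card I\<close> from sharing the area among at most that
  many free points.\<close>

lemma rescaled_weight_le:
  assumes pq: "p $ 1 \<noteq> q $ 1" "p \<in> K" "q \<in> K" and n: "n \<ge> card I + 1"
  shows "rescaled_weight p q n y \<le> strip_bound R (1 / (2 * (card I + 1) * card I)) y"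
proof -
  let ?z = "normalized i j y" and ?c = "1 / (real n * (q $ 1 - p $ 1))"
  let ?b = "1 / (2 * (real (card I) + 1) * card I)"
  show ?thesis
  proof (cases "(\<forall>r\<in>R. shear p q ?c (y r) \<in> K) \<and> indexed_convex_position I ?z \<and> spans I i j ?z")
    case False
    then have "rescaled_weight p q n y = 0"
      using I by (auto simp: rescaled_weight_def prod_zero_iff indicator_def)
    then show ?thesis by simp
  next
    case True
    have z: "?z r = y r" if "r \<in> R" for r using that by (simp add: normalized_def)
    have t: "y r $ 1 \<in> {0..1}" if "r \<in> R" for r
      using True that z[OF that] spans_normalized[where X = ?z and i = i and j = j and I = I, OF normalized_nth] by (metis Diff_iff)
    have "shear p q ?c (?z l) \<in> K" if "l \<in> I" for l
      using True pq that by (cases "l = i \<or> l = j") (auto simp: normalized_nth shear_0 shear_axis z)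
    then have "hull_area I (\<lambda>l. shear p q ?c (?z l)) \<le> 1"
      by (rule hull_area_le_1[OF I(1)])
    then have A1: "hull_area I ?z \<le> n"
      using pq n by (simp add: hull_area_shear[OF I(1)] abs_mult divide_simps split: if_splits)
    have A0: "0 \<le> hull_area I ?z" by (simp add: hull_area_def)
    have card: "card I > 0" "card R \<le> card I" using I by (auto simp: card_gt_0_iff intro: card_mono)
    have "(\<Sum>r\<in>R. ?b * \<bar>y r $ 2\<bar>) \<le> (\<Sum>r\<in>R. ?b * (2 * hull_area I ?z))"
    proof (intro sum_mono mult_left_mono)
      fix r assume r: "r \<in> R"
      then show "\<bar>y r $ 2\<bar> \<le> 2 * hull_area I ?z"
        using hull_area_ge_height[where X = ?z and r = r and i = i and j = j, OF I(1-3) _ normalized_nth]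
        by (simp add: z)
    qed simp
    also have "\<dots> = card R * (?b * (2 * hull_area I ?z))" by simp
    also have "\<dots> \<le> card I * (?b * (2 * hull_area I ?z))"
      using card A0 by (intro mult_right_mono) auto
    also have "\<dots> = hull_area I ?z / (card I + 1)"
      using card by (simp add: divide_simps)
    finally have sum: "(\<Sum>r\<in>R. ?b * \<bar>y r $ 2\<bar>) \<le> hull_area I ?z / (card I + 1)" .
    have "rescaled_weight p q n y = ennreal ((1 - hull_area I ?z / n) ^ (n - card I))"
      using True by (simp add: rescaled_weight_def)
    also have "\<dots> \<le> ennreal (exp (- (hull_area I ?z / (card I + 1))))"
      by (intro ennreal_leI one_minus_power_le_exp A0 A1 n)
    also have "\<dots> \<le> ennreal (exp (\<Sum>r\<in>R. - ?b * \<bar>y r $ 2\<bar>))"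
      using sum by (intro ennreal_leI) (simp add: sum_negf)
    also have "\<dots> = (\<Prod>r\<in>R. ennreal (exp (- ?b * \<bar>y r $ 2\<bar>)))"
      using I by (simp add: exp_sum prod_ennreal)
    also have "\<dots> = strip_bound R ?b y"
      using t by (simp add: strip_bound_def)
    finally show ?thesis by (simp add: algebra_simps)
  qed
qed

text \<open>The vertical displacement vanishes like \<open>1 / n\<close>. Spanning keeps the first
  coordinate in \<open>[0, 1]\<close>, so each sheared point tends to a point of the segment from
  \<open>p\<close> to \<open>q\<close>. This segment is interior to \<open>K\<close> by convexity,
  so eventually the condition on \<open>K\<close> holds.\<close>

lemma tendsto_rescaled_weight:
  assumes pq: "p $ 1 \<noteq> q $ 1" "p \<in> interior K" "q \<in> interior K"
  shows "(\<lambda>n. rescaled_weight p q n y) \<longlonglongrightarrow> limit_weight I i j (normalized i j y)"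
proof (cases "indexed_convex_position I (normalized i j y) \<and> spans I i j (normalized i j y)")
  case False
  then show ?thesis by (simp add: rescaled_weight_def limit_weight_def)
next
  case True
  let ?z = "normalized i j y"
  have ev: "eventually (\<lambda>n. shear p q (1 / (real n * (q $ 1 - p $ 1))) (y r) \<in> K) sequentially" if r: "r \<in> R" for r
  proof -
    have t: "y r $ 1 \<in> {0..1}"
      using True r spans_normalized[where X = "normalized i j y" and i = i and j = j and I = I, OF normalized_nth] by (metis Diff_iff fun_upd_other insertCI normalized_def)
    have "(\<lambda>n. shear p q (1 / (real n * (q $ 1 - p $ 1))) (y r)) \<longlonglongrightarrow>
        p + (y r $ 1 *\<^sub>R (q - p) + ((0 * inverse (q $ 1 - p $ 1)) * y r $ 2) *\<^sub>R axis 2 1)"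
      unfolding shear_def divide_inverse inverse_mult_distrib mult_1_left
      by (intro tendsto_intros lim_inverse_n)
    also have "p + (y r $ 1 *\<^sub>R (q - p) + ((0 * inverse (q $ 1 - p $ 1)) * y r $ 2) *\<^sub>R axis 2 1) = 
        (1 - y r $ 1) *\<^sub>R p + y r $ 1 *\<^sub>R q" by (simp add: algebra_simps)
    finally have lim: "(\<lambda>n. shear p q (1 / (real n * (q $ 1 - p $ 1))) (y r)) \<longlonglongrightarrow> (1 - y r $ 1) *\<^sub>R p + y r $ 1 *\<^sub>R q" .
    have "convex (interior K)" using K by (simp add: convex_body_def convex_interior)
    then have "(1 - y r $ 1) *\<^sub>R p + y r $ 1 *\<^sub>R q \<in> interior K"
      using pq t by (intro convexD) auto
    then have "eventually (\<lambda>n. shear p q (1 / (real n * (q $ 1 - p $ 1))) (y r) \<in> interior K) sequentially"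
      using lim open_interior topological_tendstoD by blast
    then show ?thesis by eventually_elim (use interior_subset in auto)
  qed
  have "eventually (\<lambda>n. \<forall>r\<in>R. shear p q (1 / (real n * (q $ 1 - p $ 1))) (y r) \<in> K) sequentially"
    using ev I by (intro eventually_ball_finite) auto
  then have "eventually (\<lambda>n. ennreal ((1 - hull_area I ?z / n) ^ (n - card I)) = rescaled_weight p q n y) sequentially"
    by eventually_elim (use True in \<open>simp add: rescaled_weight_def\<close>)
  moreover have "(\<lambda>n. ennreal ((1 - hull_area I ?z / n) ^ (n - card I))) \<longlonglongrightarrow> ennreal (exp (- hull_area I ?z))"
    by (intro tendsto_ennrealI tendsto_one_minus_power_diff)
  moreover have "limit_weight I i j ?z = ennreal (exp (- hull_area I ?z))"
    using True by (simp add: limit_weight_def)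
  ultimately show ?thesis using Lim_transform_eventually by fastforce
qed

end


section \<open>Null sets and almost sure properties\<close>

lemma null_sets_lborel_if_negligible:
  assumes "negligible S" "S \<in> sets borel"
  shows "S \<in> null_sets lborel"
  using assms by (simp add: negligible_iff_null_sets null_sets_completion_iff)

lemma AE_lborel_notin_hyperplane:
  fixes a :: "'a::euclidean_space"
  assumes "a \<noteq> 0"
  shows "AE x in lborel. a \<bullet> x \<noteq> b"
proof -
  have "{x. a \<bullet> x = b} \<in> null_sets lborel"
    using assms by (intro null_sets_lborel_if_negligible negligible_hyperplane) auto
  then show ?thesis by (rule AE_I'[where N = "{x. a \<bullet> x = b}"]) auto
qed

text \<open>Fubini in the coordinate \<open>c\<close>: if, for every choice of the other
  coordinates, the exceptional values of this one are null, then the whole exceptional set is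
  null.\<close>

lemma AE_PiM_update:
  assumes U: "prob_space U" and N: "finite N" "c \<in> N"
    and P[measurable]: "Measurable.pred (Pi\<^sub>M N (\<lambda>_. U)) P"
    and AE: "\<And>x. x \<in> space (Pi\<^sub>M (N - {c}) (\<lambda>_. U)) \<Longrightarrow> AE y in U. P (x(c := y))"
  shows "AE x in Pi\<^sub>M N (\<lambda>_. U). P x"
proof -
  interpret U: prob_space U by fact
  interpret product_sigma_finite "\<lambda>_. U" by standard
  have ins: "N = insert c (N - {c})" using N by auto
  have P': "Measurable.pred (Pi\<^sub>M (insert c (N - {c})) (\<lambda>_. U)) P"
    using P ins by simp
  have "(\<integral>\<^sup>+x. indicator {x. \<not> P x} x \<partial>Pi\<^sub>M N (\<lambda>_. U)) =
     (\<integral>\<^sup>+x. \<integral>\<^sup>+y. indicator {x. \<not> P x} (x(c := y)) \<partial>U \<partial>Pi\<^sub>M (N - {c}) (\<lambda>_. U))"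
    using N P' by (subst (1) ins, subst product_nn_integral_insert) auto
  also have "\<dots> = (\<integral>\<^sup>+x. 0 \<partial>Pi\<^sub>M (N - {c}) (\<lambda>_. U))"
  proof (rule nn_integral_cong)
    fix x assume "x \<in> space (Pi\<^sub>M (N - {c}) (\<lambda>_. U))"
    from AE[OF this] have "AE y in U. indicator {x. \<not> P x} (x(c := y)) = (0::ennreal)"
      by eventually_elim simp
    then have "(\<integral>\<^sup>+y. indicator {x. \<not> P x} (x(c := y)) \<partial>U) = (\<integral>\<^sup>+y. 0 \<partial>U)"
      by (rule nn_integral_cong_AE)
    then show "(\<integral>\<^sup>+y. indicator {x. \<not> P x} (x(c := y)) \<partial>U) = 0" by simp
  qed
  finally show ?thesis by (simp add: AE_iff_nn_integral)
qed

context unit_area_body begin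

lemma sets_U: "sets U = sets borel"
  by simp

lemma AE_U_if_AE_lborel: "(AE x in lborel. P x) \<Longrightarrow> AE x in U. P x"
  using K_borel by (intro AE_uniform_measureI) auto

text \<open>The frontier of a convex set is null. Interior points matter because only for interior
  \<open>p\<close> and \<open>q\<close> is the condition on \<open>K\<close> shown to disappear in
  the limit.\<close>

lemma AE_U_interior: "AE x in U. x \<in> interior K"
proof (rule AE_uniform_measureI)
  have "negligible (frontier K)"
    using K by (intro negligible_convex_frontier) (simp add: convex_body_def)
  then have "frontier K \<in> null_sets lborel"
    by (rule null_sets_lborel_if_negligible) (simp add: borel_closed)
  moreover have "closed K" using K by (simp add: convex_body_def compact_imp_closed)
  ultimately show "AE x in lborel. x \<in> K \<longrightarrow> x \<in> interior K"
    by (intro AE_I'[where N = "frontier K"]) (auto simp: frontier_def closure_closed)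
qed (simp add: K_borel)

lemma AE_U_mem: "AE x in U. x \<in> K"
  using AE_U_interior by eventually_elim (use interior_subset in auto)

lemma AE_U_first_coordinate: "AE x in U. x $ 1 \<noteq> a"
proof (rule AE_U_if_AE_lborel)
  show "AE x in lborel. (x :: real^2) $ 1 \<noteq> a"
    using AE_lborel_notin_hyperplane[of "axis 1 1 :: real^2" a] by (simp add: inner_axis')
qed

end

section \<open>Averaging over the spanning pair\<close>

context unit_area_pair begin

text \<open>For fixed \<open>p\<close> and \<open>q\<close> the integral over the other points
  converges by dominated convergence with \<open>strip_bound\<close>. For large \<open>n\<close>
  these integrals are at most \<open>W\<close> for almost all pairs, so a second dominated
  convergence integrates over the pair. The limit there is constant, and the pairs have total mass
  one.\<close>

lemma pair_limit_finite: "pair_limit I i j < \<infinity>" and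
  tendsto_nn_integral_hole_weight:
  "(\<lambda>n. ennreal (real n ^ card R) * (\<integral>\<^sup>+x. hole_weight I i j (n - card I) x \<partial>Pi\<^sub>M I (\<lambda>_. U)))
     \<longlonglongrightarrow> pair_limit I i j"
proof -
  interpret U: prob_space U by (rule prob_space_U)
  interpret PU: product_sigma_finite "\<lambda>_. U" by standard
  interpret pair_prob_space U U by standard
  let ?k = "card I"
  define c where "c = 1 / real (2 * (?k + 1) * ?k)"
  define W where "W = (\<integral>\<^sup>+y. strip_bound R c y \<partial>Pi\<^sub>M R (\<lambda>_. lborel))"
  have "?k > 0" using I by (auto simp: card_gt_0_iff)
  then have c: "c > 0" by (simp add: c_def del: of_nat_mult of_nat_add)
  have W: "W < \<infinity>" unfolding W_def using I c by (intro nn_integral_strip_bound_finite) auto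
  have R: "finite R" "i \<notin> R" "j \<notin> insert i R" and ins: "I = insert j (insert i R)"
    using I by auto
  \<comment> \<open>\<open>fst z\<close> is the point \<open>q\<close> at \<open>j\<close> and
    \<open>snd z\<close> the point \<open>p\<close> at \<open>i\<close>, because \<open>j\<close> is
    the coordinate integrated outermost.\<close>
  define G where "G n z = ennreal (real n ^ card R) *
    (\<integral>\<^sup>+x. hole_weight I i j (n - ?k) (x(i := snd z, j := fst z)) \<partial>Pi\<^sub>M R (\<lambda>_. U))" for n z
  have sf: "sigma_finite_measure (Pi\<^sub>M R (\<lambda>_. U))" by (rule PU.sigma_finite[OF R(1)])
  have joint: "(\<lambda>v. hole_weight I i j m ((snd v)(i := snd (fst v), j := fst (fst v)))) \<in>
      borel_measurable ((U \<Otimes>\<^sub>M U) \<Otimes>\<^sub>M Pi\<^sub>M R (\<lambda>_. U))" for m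
  proof (rule measurable_hole_weight[OF I(1-3)])
    fix l assume l: "l \<in> I"
    let ?P = "(U \<Otimes>\<^sub>M U) \<Otimes>\<^sub>M Pi\<^sub>M R (\<lambda>_. U)"
    have "(\<lambda>v. ((snd v)(i := snd (fst v), j := fst (fst v))) l) \<in> measurable ?P U"
    proof (cases "l = i \<or> l = j")
      case False
      then have "(\<lambda>v. snd v l) \<in> measurable ?P U"
        using l by (intro measurable_compose[OF measurable_snd] measurable_component_singleton) auto
      then show ?thesis using False by simp
    next
      case True
      have "(\<lambda>v. fst (fst v)) \<in> measurable ?P U" "(\<lambda>v. snd (fst v)) \<in> measurable ?P U"
        by (intro measurable_compose[OF measurable_fst] measurable_fst measurable_snd)+
      then show ?thesis using True by (cases "l = j") auto
    qed
    then show "(\<lambda>v. ((snd v)(i := snd (fst v), j := fst (fst v))) l) \<in> borel_measurable ?P"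
      using measurable_cong_sets[OF refl sets_U, of ?P] by blast
  qed
  have G[measurable]: "G n \<in> borel_measurable (U \<Otimes>\<^sub>M U)" for n
    unfolding G_def[abs_def]
    using sigma_finite_measure.borel_measurable_nn_integral_fst[OF sf joint] by simp
  have hw: "hole_weight I i j m \<in> borel_measurable (Pi\<^sub>M (insert j (insert i R)) (\<lambda>_. U))" for m
    unfolding ins[symmetric]
    using measurable_component_singleton[of _ I "\<lambda>_. U"] measurable_cong_sets[OF refl sets_U]
    by (intro measurable_hole_weight[OF I(1-3)]) blast
  have eqG: "ennreal (real n ^ card R) * (\<integral>\<^sup>+x. hole_weight I i j (n - ?k) x \<partial>Pi\<^sub>M I (\<lambda>_. U)) =
      (\<integral>\<^sup>+z. G n z \<partial>(U \<Otimes>\<^sub>M U))" for n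
  proof -
    have "(\<integral>\<^sup>+x. hole_weight I i j (n - ?k) x \<partial>Pi\<^sub>M I (\<lambda>_. U)) =
       (\<integral>\<^sup>+q. \<integral>\<^sup>+x. hole_weight I i j (n - ?k) (x(j := q)) \<partial>Pi\<^sub>M (insert i R) (\<lambda>_. U) \<partial>U)"
      using R hw by (subst ins, subst PU.product_nn_integral_insert_rev) auto
    also have "\<dots> = (\<integral>\<^sup>+q. \<integral>\<^sup>+p. \<integral>\<^sup>+x. hole_weight I i j (n - ?k) (x(i := p, j := q)) \<partial>Pi\<^sub>M R (\<lambda>_. U) \<partial>U \<partial>U)"
    proof (rule nn_integral_cong)
      fix q assume q: "q \<in> space U"
      have "(\<lambda>x. hole_weight I i j (n - ?k) (x(j := q))) \<in> borel_measurable (Pi\<^sub>M (insert i R) (\<lambda>_. U))"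
        using R q by (intro measurable_compose[OF _ hw]) measurable
      then show "(\<integral>\<^sup>+x. hole_weight I i j (n - ?k) (x(j := q)) \<partial>Pi\<^sub>M (insert i R) (\<lambda>_. U)) =
        (\<integral>\<^sup>+p. \<integral>\<^sup>+x. hole_weight I i j (n - ?k) (x(i := p, j := q)) \<partial>Pi\<^sub>M R (\<lambda>_. U) \<partial>U)"
        using R by (subst PU.product_nn_integral_insert_rev) auto
    qed
    finally have "ennreal (real n ^ card R) * (\<integral>\<^sup>+x. hole_weight I i j (n - ?k) x \<partial>Pi\<^sub>M I (\<lambda>_. U)) =
      ennreal (real n ^ card R) * (\<integral>\<^sup>+z. \<integral>\<^sup>+x. hole_weight I i j (n - ?k) (x(i := snd z, j := fst z)) \<partial>Pi\<^sub>M R (\<lambda>_. U) \<partial>(U \<Otimes>\<^sub>M U))"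
      using U.nn_integral_fst[OF sigma_finite_measure.borel_measurable_nn_integral_fst[OF sf joint], of "n - ?k"]
      by simp
    also have "\<dots> = (\<integral>\<^sup>+z. G n z \<partial>(U \<Otimes>\<^sub>M U))"
      unfolding G_def
      using sigma_finite_measure.borel_measurable_nn_integral_fst[OF sf joint]
      by (subst nn_integral_cmult) auto
    finally show ?thesis .
  qed
  have le: "rescaled_weight p q n y \<le> strip_bound R c y"
    if "p $ 1 \<noteq> q $ 1" "p \<in> K" "q \<in> K" "n \<ge> ?k + 1" for p q n y
    using rescaled_weight_le[OF that] by (simp add: c_def)
  have G_le: "G n z \<le> W"
    if "snd z $ 1 \<noteq> fst z $ 1" "snd z \<in> K" "fst z \<in> K" "n \<ge> ?k + 1" for n z
    unfolding G_def W_def using that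
    by (subst nn_integral_rescale) (auto intro!: nn_integral_mono le)
  \<comment> \<open>The bounds start at \<open>card I + 1\<close>, so the sequences are shifted to
    make domination hold for every term.\<close>
  have off: "(\<lambda>n. f (n + (?k + 1))) \<longlonglongrightarrow> l \<Longrightarrow> f \<longlonglongrightarrow> l" for f and l :: ennreal
    by (rule LIMSEQ_offset)
  have lw: "(\<lambda>y. limit_weight I i j (normalized i j y)) \<in> borel_measurable (Pi\<^sub>M R (\<lambda>_. lborel))"
    unfolding normalized_def by (intro measurable_limit_weight I measurable_update2) auto
  have G_lim: "(\<lambda>n. G n z) \<longlonglongrightarrow> pair_limit I i j"
    if z: "snd z $ 1 \<noteq> fst z $ 1" "snd z \<in> interior K" "fst z \<in> interior K" for z
  proof (rule off)
    have zK: "snd z \<in> K" "fst z \<in> K" using z interior_subset by auto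
    have "(\<lambda>n. \<integral>\<^sup>+y. rescaled_weight (snd z) (fst z) (n + (?k + 1)) y \<partial>Pi\<^sub>M R (\<lambda>_. lborel)) \<longlonglongrightarrow>
       (\<integral>\<^sup>+y. limit_weight I i j (normalized i j y) \<partial>Pi\<^sub>M R (\<lambda>_. lborel))"
    proof (rule nn_integral_dominated_convergence[where w = "strip_bound R c"])
      show "(\<integral>\<^sup>+y. strip_bound R c y \<partial>Pi\<^sub>M R (\<lambda>_. lborel)) < \<infinity>" using W by (simp add: W_def)
      show "AE y in Pi\<^sub>M R (\<lambda>_. lborel). rescaled_weight (snd z) (fst z) (n + (?k + 1)) y \<le> strip_bound R c y" for n
        using z zK by (intro AE_I2 le) auto
      show "AE y in Pi\<^sub>M R (\<lambda>_. lborel). (\<lambda>n. rescaled_weight (snd z) (fst z) (n + (?k + 1)) y) \<longlonglongrightarrow>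
          limit_weight I i j (normalized i j y)"
        using z by (intro AE_I2 LIMSEQ_ignore_initial_segment tendsto_rescaled_weight) auto
    qed (intro measurable_rescaled_weight measurable_strip_bound lw)+
    moreover have "G (n + (?k + 1)) z = (\<integral>\<^sup>+y. rescaled_weight (snd z) (fst z) (n + (?k + 1)) y \<partial>Pi\<^sub>M R (\<lambda>_. lborel))" for n
      unfolding G_def using z by (intro nn_integral_rescale) auto
    ultimately show "(\<lambda>n. G (n + (?k + 1)) z) \<longlonglongrightarrow> pair_limit I i j"
      by (simp add: pair_limit_def)
  qed
  have AE: "AE z in U \<Otimes>\<^sub>M U. snd z $ 1 \<noteq> fst z $ 1 \<and> snd z \<in> interior K \<and> fst z \<in> interior K"
  proof (rule AE_pair_measure)
    have [measurable]: "(\<lambda>x. x $ 1) \<in> borel_measurable U" "interior K \<in> sets U" by auto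
    show "{z \<in> space (U \<Otimes>\<^sub>M U). snd z $ 1 \<noteq> fst z $ 1 \<and> snd z \<in> interior K \<and> fst z \<in> interior K} \<in> sets (U \<Otimes>\<^sub>M U)"
      by measurable
    show "AE q in U. AE p in U. snd (q, p) $ 1 \<noteq> fst (q, p) $ 1 \<and> snd (q, p) \<in> interior K \<and> fst (q, p) \<in> interior K"
      using AE_U_interior
    proof eventually_elim
      case (elim q)
      show ?case using AE_U_interior AE_U_first_coordinate[of "q $ 1"]
        by eventually_elim (use elim in auto)
    qed
  qed
  have "(\<lambda>n. \<integral>\<^sup>+z. G (n + (?k + 1)) z \<partial>(U \<Otimes>\<^sub>M U)) \<longlonglongrightarrow> (\<integral>\<^sup>+z. pair_limit I i j \<partial>(U \<Otimes>\<^sub>M U))"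
  proof (rule nn_integral_dominated_convergence[where w = "\<lambda>_. W"])
    show "AE z in U \<Otimes>\<^sub>M U. G (n + (?k + 1)) z \<le> W" for n
      using AE by eventually_elim (use interior_subset in \<open>auto intro!: G_le\<close>)
    show "AE z in U \<Otimes>\<^sub>M U. (\<lambda>n. G (n + (?k + 1)) z) \<longlonglongrightarrow> pair_limit I i j"
      using AE by eventually_elim (intro LIMSEQ_ignore_initial_segment G_lim, auto)
  qed (use W P.emeasure_space_1 in simp_all)
  then have "(\<lambda>n. \<integral>\<^sup>+z. G n z \<partial>(U \<Otimes>\<^sub>M U)) \<longlonglongrightarrow> pair_limit I i j"
    using off[of "\<lambda>n. \<integral>\<^sup>+z. G n z \<partial>(U \<Otimes>\<^sub>M U)"] P.emeasure_space_1 by simp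
  then show "(\<lambda>n. ennreal (real n ^ card R) * (\<integral>\<^sup>+x. hole_weight I i j (n - ?k) x \<partial>Pi\<^sub>M I (\<lambda>_. U)))
     \<longlonglongrightarrow> pair_limit I i j"
    by (simp add: eqG)
  \<comment> \<open>A good pair exists because almost every pair in a probability space is good. At
    such a pair the limit inherits the bound \<open>W\<close>, hence is finite.\<close>
  obtain z where z: "snd z $ 1 \<noteq> fst z $ 1" "snd z \<in> interior K" "fst z \<in> interior K"
    using eventually_happens'[OF P.ae_filter_bot AE] by blast
  have "pair_limit I i j \<le> W"
    using G_lim[OF z, THEN LIMSEQ_ignore_initial_segment, of "?k + 1"]
    by (rule LIMSEQ_le_const2) (use z interior_subset in \<open>auto intro!: exI[of _ 0] G_le\<close>)
  then show "pair_limit I i j < \<infinity>" using W by (rule le_less_trans)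
qed

end


section \<open>Counting holes\<close>

text \<open>Twice the signed area of the triangle \<open>a\<close>, \<open>b\<close>,
  \<open>c\<close>. As a polynomial it turns collinearity into a measurable condition and, for fixed
  \<open>a\<close> and \<open>b\<close>, into a linear equation in \<open>c\<close>.\<close>

definition cross :: "real^2 \<Rightarrow> real^2 \<Rightarrow> real^2 \<Rightarrow> real" where
  "cross a b c = (b $ 1 - a $ 1) * (c $ 2 - a $ 2) - (b $ 2 - a $ 2) * (c $ 1 - a $ 1)"

lemma collinear_iff_cross: "collinear {a, b, c} \<longleftrightarrow> cross a b c = 0"
proof
  assume "collinear {a, b, c}"
  then have "a = c \<or> (\<exists>u. b = u *\<^sub>R a + (1 - u) *\<^sub>R c)"
    by (simp add: collinear_3_expand)
  then show "cross a b c = 0"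
  proof (elim disjE exE)
    fix u assume b: "b = u *\<^sub>R a + (1 - u) *\<^sub>R c"
    show "cross a b c = 0" unfolding b cross_def by (simp add: algebra_simps)
  qed (simp add: cross_def)
next
  assume 0: "cross a b c = 0"
  show "collinear {a, b, c}"
  proof (cases "a = c")
    case False
    then consider "a $ 1 \<noteq> c $ 1" | "a $ 2 \<noteq> c $ 2" by (auto simp: vec_eq_iff forall_2)
    \<comment> \<open>Distinct \<open>a\<close> and \<open>c\<close> differ in some coordinate.
      Solving for \<open>u\<close> in that coordinate gives the witness, and the vanishing of
      \<open>cross\<close> settles the other coordinate.\<close>
    then have "\<exists>u. b = u *\<^sub>R a + (1 - u) *\<^sub>R c"
    proof cases
      case 1
      then show ?thesis using 0
        by (intro exI[of _ "(b $ 1 - c $ 1) / (a $ 1 - c $ 1)"])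
          (simp add: vec_eq_iff forall_2 divide_simps cross_def, simp add: algebra_simps)
    next
      case 2
      then show ?thesis using 0
        by (intro exI[of _ "(b $ 2 - c $ 2) / (a $ 2 - c $ 2)"])
          (simp add: vec_eq_iff forall_2 divide_simps cross_def, simp add: algebra_simps)
    qed
    then show ?thesis by (simp add: collinear_3_expand)
  qed (simp add: collinear_3_expand)
qed

text \<open>Distinctness is required of the values, not of the indices, so the equivalence holds
  also when points coincide. The quantifiers range over indices, as measurability needs.\<close>

lemma general_position_image_iff:
  "general_position (X ` N) \<longleftrightarrow> (\<forall>a\<in>N. \<forall>b\<in>N. \<forall>c\<in>N.
     X a \<noteq> X b \<longrightarrow> X b \<noteq> X c \<longrightarrow> X a \<noteq> X c \<longrightarrow> cross (X a) (X b) (X c) \<noteq> 0)"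
proof
  assume *: "general_position (X ` N)"
  show "\<forall>a\<in>N. \<forall>b\<in>N. \<forall>c\<in>N. X a \<noteq> X b \<longrightarrow> X b \<noteq> X c \<longrightarrow> X a \<noteq> X c \<longrightarrow> cross (X a) (X b) (X c) \<noteq> 0"
  proof (intro ballI impI)
    fix a b c assume "a \<in> N" "b \<in> N" "c \<in> N" "X a \<noteq> X b" "X b \<noteq> X c" "X a \<noteq> X c"
    then have "{X a, X b, X c} \<subseteq> X ` N" "card {X a, X b, X c} = 3" by auto
    then have "\<not> collinear {X a, X b, X c}" using * unfolding general_position_def by blast
    then show "cross (X a) (X b) (X c) \<noteq> 0" by (simp add: collinear_iff_cross)
  qed
next
  assume *: "\<forall>a\<in>N. \<forall>b\<in>N. \<forall>c\<in>N. X a \<noteq> X b \<longrightarrow> X b \<noteq> X c \<longrightarrow> X a \<noteq> X c \<longrightarrow> cross (X a) (X b) (X c) \<noteq> 0"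
  show "general_position (X ` N)"
    unfolding general_position_def
  proof (intro allI impI)
    fix T assume T: "T \<subseteq> X ` N" "card T = 3"
    obtain x y z where xyz: "T = {x, y, z}" "x \<noteq> y" "y \<noteq> z" "x \<noteq> z"
      using T(2) by (auto simp: card_3_iff)
    then obtain a b c where "a \<in> N" "b \<in> N" "c \<in> N" "x = X a" "y = X b" "z = X c" using T(1) by auto
    with * xyz have "cross x y z \<noteq> 0" by blast
    then show "\<not> collinear T" by (simp add: xyz collinear_iff_cross)
  qed
qed

definition hole_event :: "'i set \<Rightarrow> 'i set \<Rightarrow> ('i \<Rightarrow> real^2) \<Rightarrow> bool" where
  "hole_event N I X \<longleftrightarrow> general_position (X ` N) \<and> indexed_convex_position I X \<and>
     (\<forall>l\<in>N. X l \<notin> interior (convex hull (X ` I)))"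

definition first_occurrences :: "nat set \<Rightarrow> (nat \<Rightarrow> 'a) \<Rightarrow> bool" where
  "first_occurrences I X \<longleftrightarrow> (\<forall>i\<in>I. \<forall>j<i. X j \<noteq> X i)"

lemma is_hole_image_iff:
  assumes "finite N" "I \<subseteq> N" "card I = k"
  shows "inj_on X I \<and> is_hole k (X ` N) (X ` I) \<longleftrightarrow> hole_event N I X"
proof -
  have "finite I" using assms finite_subset by blast
  then show ?thesis
    using assms
    by (auto simp: is_hole_def hole_event_def indexed_convex_position_iff card_image)
qed

text \<open>The random points may coincide; counting only index sets of first occurrences makes the
  correspondence with holes exact on the whole sample space, hence gives measurability there.\<close>

lemma num_holes_eq_card:
  "num_holes k (X ` {..<n}) =
     card {I. I \<subseteq> {..<n} \<and> card I = k \<and> first_occurrences I X \<and> hole_event {..<n} I X}"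
    (is "_ = card ?A")
proof -
  have inj: "inj_on X I" if "first_occurrences I X" for I
    using that unfolding first_occurrences_def inj_on_def by (metis linorder_neqE_nat)
  have "bij_betw ((`) X) ?A {H. is_hole k (X ` {..<n}) H}"
  proof (rule bij_betwI')
    fix I I' assume "I \<in> ?A" "I' \<in> ?A"
    then have f: "first_occurrences I X" "first_occurrences I' X" by auto
    \<comment> \<open>A first occurrence is determined by its value, so inclusion of the values
      gives inclusion of the index sets.\<close>
    have sub: "A \<subseteq> B" if AB: "X ` A \<subseteq> X ` B" "first_occurrences A X" "first_occurrences B X" for A B
    proof
      fix a assume a: "a \<in> A"
      then obtain b where b: "b \<in> B" "X a = X b" using AB by blast
      then have "a = b"
        using AB a unfolding first_occurrences_def by (metis linorder_neqE_nat)
      then show "a \<in> B" using b by simp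
    qed
    show "(X ` I = X ` I') = (I = I')"
      using sub[of I I'] sub[of I' I] f by auto
  next
    fix I assume "I \<in> ?A"
    then show "X ` I \<in> {H. is_hole k (X ` {..<n}) H}"
      using is_hole_image_iff[of "{..<n}" I k X] by auto
  next
    fix H assume "H \<in> {H. is_hole k (X ` {..<n}) H}"
    then have H: "is_hole k (X ` {..<n}) H" by simp
    \<comment> \<open>The only index set of first occurrences that can represent \<open>H\<close>:
      the least index at which each of its points appears.\<close>
    define I where "I = {i. i < n \<and> X i \<in> H \<and> (\<forall>j<i. X j \<noteq> X i)}"
    have f: "first_occurrences I X" by (auto simp: I_def first_occurrences_def)
    have "H \<subseteq> X ` I"
    proof
      fix h assume h: "h \<in> H"
      then obtain m where m: "m < n" "X m = h" using H by (auto simp: is_hole_def)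
      define i where "i = (LEAST i. X i = h)"
      have "X i = h" "i \<le> m" "\<forall>j<i. X j \<noteq> h"
        unfolding i_def using m by (auto intro: LeastI Least_le dest: not_less_Least)
      then show "h \<in> X ` I" using m h by (intro image_eqI[of _ _ i]) (auto simp: I_def)
    qed
    then have XI: "X ` I = H" by (auto simp: I_def)
    have "card I = k" using card_image[OF inj[OF f]] XI H by (simp add: is_hole_def)
    moreover have "I \<subseteq> {..<n}" by (auto simp: I_def)
    ultimately show "\<exists>I\<in>?A. H = X ` I"
      using is_hole_image_iff[of "{..<n}" I k X] f inj[OF f] H XI by (intro bexI[of _ I]) auto
  qed
  then show ?thesis
    unfolding num_holes_def by (rule bij_betw_same_card[symmetric])
qed

definition position_weight :: "'i set \<Rightarrow> nat \<Rightarrow> ('i \<Rightarrow> real^2) \<Rightarrow> ennreal" where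
  "position_weight I m X = indicator {X. indexed_convex_position I X} X * ennreal ((1 - hull_area I X) ^ m)"

text \<open>The pair consists of the indices of the leftmost and the rightmost point. Requiring
  \<open>i < j\<close> counts this unordered pair once.\<close>

lemma ex1_spanning_pair:
  fixes X :: "nat \<Rightarrow> real^2"
  assumes k: "k \<ge> 2" and inj: "inj_on (\<lambda>l. X l $ 1) {..<k}"
  shows "card {(i, j). i < j \<and> j < k \<and> spans {..<k} i j X} = 1"
proof -
  let ?f = "\<lambda>l. X l $ 1"
  have ne: "{..<k} \<noteq> {}" "finite {..<k}" using k by (auto simp: lessThan_empty_iff)
  have "Min (?f ` {..<k}) \<in> ?f ` {..<k}" using ne by (intro Min_in) auto
  then obtain a where "a < k" "Min (?f ` {..<k}) = ?f a" by auto
  then have a: "a < k" "\<And>l. l < k \<Longrightarrow> ?f a \<le> ?f l"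
    using Min_le[of "?f ` {..<k}"] by auto
  have "Max (?f ` {..<k}) \<in> ?f ` {..<k}" using ne by (intro Max_in) auto
  then obtain b where "b < k" "Max (?f ` {..<k}) = ?f b" by auto
  then have b: "b < k" "\<And>l. l < k \<Longrightarrow> ?f l \<le> ?f b"
    using Max_ge[of "?f ` {..<k}"] by auto
  have eq: "l = m" if "?f l = ?f m" "l < k" "m < k" for l m using inj that by (auto simp: inj_on_def)
  have ab: "a \<noteq> b"
  proof
    assume "a = b"
    then have "?f 0 = ?f 1" using a(2)[of 0] a(2)[of 1] b(2)[of 0] b(2)[of 1] k by force
    then show False using eq[of 0 1] k by simp
  qed
  have sp: "spans {..<k} a b X" "spans {..<k} b a X"
    unfolding spans_def using a b by (auto simp: mult_le_0_iff)
  have "{i, j} = {a, b}" if "i < k" "j < k" "i \<noteq> j" "spans {..<k} i j X" for i j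
  proof -
    \<comment> \<open>At the leftmost point both factors are nonpositive, so the product is
      nonnegative, while spanning makes it nonpositive. Hence it vanishes and \<open>a\<close> is
      \<open>i\<close> or \<open>j\<close>. The rightmost point is treated alike.\<close>
    have "(?f a - ?f i) * (?f a - ?f j) = 0"
      using that a by (intro antisym mult_nonpos_nonpos) (auto simp: spans_def)
    then have "a = i \<or> a = j" using eq that a by auto
    moreover have "(?f b - ?f i) * (?f b - ?f j) = 0"
      using that b by (intro antisym mult_nonneg_nonneg) (auto simp: spans_def)
    then have "b = i \<or> b = j" using eq that b by auto
    ultimately show ?thesis using ab that by auto
  qed
  note pair = this
  have "(i < j \<and> j < k \<and> spans {..<k} i j X) \<longleftrightarrow> i = min a b \<and> j = max a b" for i j
  proof
    assume ij: "i < j \<and> j < k \<and> spans {..<k} i j X"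
    then have "{i, j} = {a, b}" by (intro pair) auto
    then have "i = a \<and> j = b \<or> i = b \<and> j = a" by (simp add: doubleton_eq_iff)
    then show "i = min a b \<and> j = max a b" using ij by auto
  next
    assume "i = min a b \<and> j = max a b"
    then show "i < j \<and> j < k \<and> spans {..<k} i j X"
      using a(1) b(1) ab sp by (cases "a < b") (auto simp: min_def max_def)
  qed
  then have "{(i, j). i < j \<and> j < k \<and> spans {..<k} i j X} = {(min a b, max a b)}" by auto
  then show ?thesis by simp
qed

text \<open>After the shift by \<open>k\<close>, \<open>fact_binomial_limit\<close> has the
  denominator \<open>n ^ k\<close> in place of \<open>(n + k) ^ k\<close>. The correcting factor
  \<open>(n / (n + k)) ^ k\<close> tends to \<open>1\<close>.\<close>

lemma binomial_over_power_limit: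
  "(\<lambda>n. real (n choose k) / real n ^ k) \<longlonglongrightarrow> 1 / fact k"
proof (rule LIMSEQ_offset[where k = k])
  have "(\<lambda>n. 1 - real k / real (n + k)) \<longlonglongrightarrow> 1 - 0"
    by (intro tendsto_diff tendsto_const LIMSEQ_ignore_initial_segment lim_const_over_n)
  moreover have "eventually (\<lambda>n. 1 - real k / real (n + k) = real n / real (n + k)) sequentially"
    using eventually_gt_at_top[of 0] by eventually_elim (simp add: field_simps)
  ultimately have "(\<lambda>n. real n / real (n + k)) \<longlonglongrightarrow> 1"
    by (simp add: tendsto_cong)
  then have "(\<lambda>n. real ((k + n) choose n) / real (n ^ k) * (real n / real (n + k)) ^ k) \<longlonglongrightarrow> 1 / fact k * 1 ^ k"
    by (intro tendsto_mult tendsto_power fact_binomial_limit)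
  moreover have "eventually (\<lambda>n. real ((k + n) choose n) / real (n ^ k) * (real n / real (n + k)) ^ k =
      real ((n + k) choose k) / real (n + k) ^ k) sequentially"
    using eventually_gt_at_top[of 0]
    by eventually_elim (use binomial_symmetric[of k "_ + k"] in \<open>simp add: power_divide add.commute\<close>)
  ultimately show "(\<lambda>n. real ((n + k) choose k) / real (n + k) ^ k) \<longlonglongrightarrow> 1 / fact k"
    by (simp add: tendsto_cong)
qed


section \<open>Measurability of the hole events\<close>

lemma pred_hole_event:
  fixes X :: "'m \<Rightarrow> 'i \<Rightarrow> real^2"
  assumes N: "finite N" "I \<subseteq> N" and f: "\<And>l. l \<in> N \<Longrightarrow> (\<lambda>\<omega>. X \<omega> l) \<in> borel_measurable M"
  shows "Measurable.pred M (\<lambda>\<omega>. hole_event N I (X \<omega>))"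
proof -
  have I: "finite I" using N finite_subset by blast
  note [measurable] = f
  have [measurable]: "(\<lambda>\<omega>. X \<omega> l $ t) \<in> borel_measurable M" if "l \<in> N" for l t
    using measurable_compose[OF f[OF that] borel_measurable_vec_nth] .
  have "Measurable.pred M (\<lambda>\<omega>. general_position (X \<omega> ` N))"
    unfolding general_position_image_iff cross_def using N by measurable
  moreover have "Measurable.pred M (\<lambda>\<omega>. indexed_convex_position I (X \<omega>))"
    using N by (intro pred_indexed_convex_position I f) auto
  moreover have "Measurable.pred M (\<lambda>\<omega>. \<forall>l\<in>N. X \<omega> l \<notin> interior (convex hull (X \<omega> ` I)))"
    using N by (intro pred_intros_finite pred_intros_logic pred_in_interior_convex_hull I f) auto
  ultimately show ?thesis unfolding hole_event_def by (intro pred_intros_logic)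
qed

lemma pred_first_occurrences:
  assumes I: "I \<subseteq> {..<n}" and f: "\<And>l. l < n \<Longrightarrow> (\<lambda>\<omega>. X \<omega> l) \<in> borel_measurable M"
  shows "Measurable.pred M (\<lambda>\<omega>. first_occurrences I (X \<omega> :: nat \<Rightarrow> real^2))"
proof -
  have "finite I" using I finite_subset by blast
  moreover have "Measurable.pred M (\<lambda>\<omega>. X \<omega> j \<noteq> X \<omega> i)" if "i \<in> I" "j \<in> {..<i}" for i j
  proof -
    have [measurable]: "(\<lambda>\<omega>. X \<omega> j) \<in> borel_measurable M" "(\<lambda>\<omega>. X \<omega> i) \<in> borel_measurable M"
      using that I by (auto intro!: f)
    show ?thesis by measurable
  qed
  ultimately show ?thesis
    unfolding first_occurrences_def lessThan_iff[symmetric]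
    by (intro pred_intros_finite) auto
qed

lemma measurable_position_weight:
  assumes I: "finite I" and f: "\<And>i. i \<in> I \<Longrightarrow> (\<lambda>\<omega>. X \<omega> i) \<in> borel_measurable M"
  shows "(\<lambda>\<omega>. position_weight I m (X \<omega>)) \<in> borel_measurable M"
proof -
  have [measurable]: "Measurable.pred M (\<lambda>\<omega>. indexed_convex_position I (X \<omega>))"
    by (rule pred_indexed_convex_position[OF I f])
  note [measurable] = borel_measurable_hull_area[OF I f]
  show ?thesis unfolding position_weight_def indicator_def by simp
qed

lemma pred_first_coordinate_neq:
  assumes [measurable]: "A \<in> borel_measurable M" "B \<in> borel_measurable M"
  shows "Measurable.pred M (\<lambda>\<omega>. (A \<omega> :: real^2) $ 1 \<noteq> (B \<omega> :: real^2) $ 1)"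
  by measurable

lemma pred_cross_neq:
  assumes [measurable]: "A \<in> borel_measurable M" "B \<in> borel_measurable M" "C \<in> borel_measurable M"
  shows "Measurable.pred M (\<lambda>\<omega>. A \<omega> $ 1 = B \<omega> $ 1 \<or> cross (A \<omega>) (B \<omega>) (C \<omega>) \<noteq> 0)"
  unfolding cross_def by measurable

section \<open>Random points are almost surely in general position\<close>

context unit_area_body begin

lemma measurable_PiM_component: "l \<in> N \<Longrightarrow> (\<lambda>x. x l) \<in> borel_measurable (Pi\<^sub>M N (\<lambda>_. U))"
  using measurable_component_singleton[of l N "\<lambda>_. U"] measurable_cong_sets[OF refl sets_U] by blast

text \<open>With all points but \<open>x b\<close> fixed, the exceptional values of
  \<open>x b\<close> form a vertical line. Distinct first coordinates give both a unique spanning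
  pair and distinct points.\<close>

lemma AE_distinct_first_coordinates:
  assumes N: "finite N"
  shows "AE x in Pi\<^sub>M N (\<lambda>_. U). inj_on (\<lambda>l. x l $ 1) N"
proof -
  have "AE x in Pi\<^sub>M N (\<lambda>_. U). x b $ 1 \<noteq> x a $ 1" if ab: "a \<in> N" "b \<in> N" "a \<noteq> b" for a b
  proof (rule AE_PiM_update[OF prob_space_U N ab(2)])
    show "Measurable.pred (Pi\<^sub>M N (\<lambda>_. U)) (\<lambda>x. x b $ 1 \<noteq> x a $ 1)"
      by (intro pred_first_coordinate_neq measurable_PiM_component ab)
    show "AE y in U. (x(b := y)) b $ 1 \<noteq> (x(b := y)) a $ 1" for x
      using AE_U_first_coordinate[of "x a $ 1"] ab by simp
  qed
  then have "AE x in Pi\<^sub>M N (\<lambda>_. U). \<forall>a\<in>N. \<forall>b\<in>N. a \<noteq> b \<longrightarrow> x b $ 1 \<noteq> x a $ 1"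
    using N by (intro AE_finite_allI) auto
  then show ?thesis by eventually_elim (auto simp: inj_on_def)
qed

lemma AE_U_cross:
  assumes "a $ 1 \<noteq> b $ 1"
  shows "AE y in U. cross a b y \<noteq> 0"
proof (rule AE_U_if_AE_lborel)
  \<comment> \<open>With this normal vector, \<open>cross a b y\<close> is the inner product of
    \<open>?n\<close> with \<open>y - a\<close>.\<close>
  let ?n = "(b $ 1 - a $ 1) *\<^sub>R axis 2 1 - (b $ 2 - a $ 2) *\<^sub>R axis 1 1 :: real^2"
  have "?n $ 2 \<noteq> 0" using assms by (simp add: axis_def)
  then have "?n \<noteq> 0" by (metis zero_index)
  then have "AE y in lborel. ?n \<bullet> y \<noteq> ?n \<bullet> a" by (rule AE_lborel_notin_hyperplane)
  then show "AE y in lborel. cross a b y \<noteq> 0"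
    by eventually_elim (simp add: cross_def inner_diff_left inner_axis' algebra_simps)
qed

lemma AE_general_position:
  assumes N: "finite N"
  shows "AE x in Pi\<^sub>M N (\<lambda>_. U). general_position (x ` N)"
proof -
  \<comment> \<open>The alternative of equal first coordinates makes the slice statement true for
    every position of the points at \<open>a\<close> and \<open>b\<close>. It is excluded afterwards
    by the distinctness of first coordinates.\<close>
  have "AE x in Pi\<^sub>M N (\<lambda>_. U). x a $ 1 = x b $ 1 \<or> cross (x a) (x b) (x c) \<noteq> 0"
    if abc: "a \<in> N" "b \<in> N" "c \<in> N" "a \<noteq> c" "b \<noteq> c" for a b c
  proof (rule AE_PiM_update[OF prob_space_U N abc(3)])
    show "Measurable.pred (Pi\<^sub>M N (\<lambda>_. U)) (\<lambda>x. x a $ 1 = x b $ 1 \<or> cross (x a) (x b) (x c) \<noteq> 0)"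
      by (intro pred_cross_neq measurable_PiM_component abc)
    show "AE y in U. (x(c := y)) a $ 1 = (x(c := y)) b $ 1 \<or>
        cross ((x(c := y)) a) ((x(c := y)) b) ((x(c := y)) c) \<noteq> 0" for x
      using AE_U_cross[of "x a" "x b"] abc by (cases "x a $ 1 = x b $ 1") auto
  qed
  then have "AE x in Pi\<^sub>M N (\<lambda>_. U). \<forall>a\<in>N. \<forall>b\<in>N. \<forall>c\<in>N. a \<noteq> c \<longrightarrow> b \<noteq> c \<longrightarrow>
      x a $ 1 = x b $ 1 \<or> cross (x a) (x b) (x c) \<noteq> 0"
    using N by (intro AE_finite_allI) auto
  then show ?thesis
    using AE_distinct_first_coordinates[OF N]
  proof eventually_elim
    case (elim x)
    show ?case
      unfolding general_position_image_iff
    proof (intro ballI impI)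
      fix a b c assume "a \<in> N" "b \<in> N" "c \<in> N" "x a \<noteq> x b" "x b \<noteq> x c" "x a \<noteq> x c"
      then show "cross (x a) (x b) (x c) \<noteq> 0"
        using elim(1) inj_onD[OF elim(2), of a b] by metis
    qed
  qed
qed

section \<open>The expected number of holes\<close>

lemma AE_PiM_mem:
  assumes N: "finite N"
  shows "AE x in Pi\<^sub>M N (\<lambda>_. U). \<forall>l\<in>N. x l \<in> K"
  using N AE_PiM_component[of N "\<lambda>_. U", OF prob_space_U _ AE_U_mem] by (intro AE_finite_allI) auto

text \<open>The frontier of the hull is null, so its interior has the same area, and convexity of
  \<open>K\<close> puts it inside \<open>K\<close>. The rest of the unit mass remains.\<close>

lemma emeasure_U_compl_interior_hull:
  assumes I: "finite I" and x: "\<And>l. l \<in> I \<Longrightarrow> x l \<in> K"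
  shows "emeasure U (- interior (convex hull (x ` I))) = ennreal (1 - hull_area I x)"
proof -
  let ?C = "convex hull (x ` I)"
  have comp: "compact ?C" by (rule compact_convex_hull_image[OF I])
  have sub: "interior ?C \<subseteq> K"
    using interior_subset[of ?C] hull_minimal[of "x ` I" K convex] x K
    by (auto simp: convex_body_def image_subset_iff)
  have "measure lborel (interior ?C) = measure lebesgue (interior ?C)" by simp
  also have "\<dots> = measure lebesgue ?C"
    using comp by (intro measure_interior compact_imp_bounded negligible_convex_frontier) auto
  also have "\<dots> = hull_area I x" using comp by (simp add: hull_area_def borel_compact)
  finally have area: "measure lborel (interior ?C) = hull_area I x" .
  have fin: "emeasure lborel (interior ?C) < \<infinity>"
    using comp by (intro emeasure_bounded_finite bounded_interior compact_imp_bounded)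
  have "emeasure U (- interior ?C) = emeasure lborel (K - interior ?C)"
    using K_borel K_emeasure by (simp add: emeasure_uniform_measure divide_ennreal_def Diff_eq)
  also have "\<dots> = emeasure lborel K - emeasure lborel (interior ?C)"
    using fin sub K_borel by (intro emeasure_Diff) auto
  also have "\<dots> = ennreal 1 - ennreal (hull_area I x)"
    using fin K_emeasure area by (simp add: emeasure_eq_ennreal_measure less_top)
  also have "\<dots> = ennreal (1 - hull_area I x)"
    by (rule ennreal_minus) (simp add: hull_area_def)
  finally show ?thesis .
qed

text \<open>Given the points of \<open>I\<close>, the other points are independent, and each misses
  the interior of the hull with probability \<open>1 - hull_area I x\<close>; these probabilities
  multiply.\<close>

lemma nn_integral_empty_position:
  assumes N: "finite N" "I \<subseteq> N"
  shows "(\<integral>\<^sup>+x. indicator {x. indexed_convex_position I x \<and>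
       (\<forall>l\<in>N - I. x l \<notin> interior (convex hull (x ` I)))} x \<partial>Pi\<^sub>M N (\<lambda>_. U)) =
     (\<integral>\<^sup>+x. position_weight I (card (N - I)) x \<partial>Pi\<^sub>M I (\<lambda>_. U))"
proof -
  interpret U: prob_space U by (rule prob_space_U)
  interpret PU: product_sigma_finite "\<lambda>_. U" by standard
  let ?J = "N - I"
  let ?E = "{x. indexed_convex_position I x \<and> (\<forall>l\<in>?J. x l \<notin> interior (convex hull (x ` I)))}"
  have I: "finite I" "finite ?J" "I \<inter> ?J = {}" "I \<union> ?J = N" using N finite_subset by auto
  have "Measurable.pred (Pi\<^sub>M N (\<lambda>_. U)) (\<lambda>x. indexed_convex_position I x \<and>
      (\<forall>l\<in>?J. x l \<notin> interior (convex hull (x ` I))))"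
    using N I by (intro pred_intros_logic pred_intros_finite pred_indexed_convex_position
        pred_in_interior_convex_hull measurable_PiM_component) auto
  then have m: "indicator ?E \<in> borel_measurable (Pi\<^sub>M (I \<union> ?J) (\<lambda>_. U))"
    unfolding I(4) indicator_def by simp
  have "(\<integral>\<^sup>+x. indicator ?E x \<partial>Pi\<^sub>M N (\<lambda>_. U)) =
     (\<integral>\<^sup>+x. \<integral>\<^sup>+y. indicator ?E (merge I ?J (x, y)) \<partial>Pi\<^sub>M ?J (\<lambda>_. U) \<partial>Pi\<^sub>M I (\<lambda>_. U))"
    using PU.product_nn_integral_fold[OF I(3,1,2) m] unfolding I(4) .
  also have "\<dots> = (\<integral>\<^sup>+x. position_weight I (card ?J) x \<partial>Pi\<^sub>M I (\<lambda>_. U))"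
  proof (rule nn_integral_cong_AE)
    show "AE x in Pi\<^sub>M I (\<lambda>_. U). (\<integral>\<^sup>+y. indicator ?E (merge I ?J (x, y)) \<partial>Pi\<^sub>M ?J (\<lambda>_. U)) =
        position_weight I (card ?J) x"
      using AE_PiM_mem[OF I(1)]
    proof eventually_elim
      case (elim x)
      let ?C = "interior (convex hull (x ` I))"
      have im: "merge I ?J (x, y) ` I' = x ` I'" if "I' \<subseteq> I" for y I'
        using that by (intro image_cong) (auto simp: merge_def)
      have pos: "indexed_convex_position I (merge I ?J (x, y)) = indexed_convex_position I x" for y
        unfolding indexed_convex_position_def using im by (simp add: merge_def)
      have "(\<integral>\<^sup>+y. indicator ?E (merge I ?J (x, y)) \<partial>Pi\<^sub>M ?J (\<lambda>_. U)) =
        (\<integral>\<^sup>+y. indicator {x. indexed_convex_position I x} x * indicator (Pi\<^sub>E ?J (\<lambda>_. - ?C)) y \<partial>Pi\<^sub>M ?J (\<lambda>_. U))"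
      proof (rule nn_integral_cong)
        fix y assume y: "y \<in> space (Pi\<^sub>M ?J (\<lambda>_. U))"
        have "(\<forall>l\<in>?J. merge I ?J (x, y) l \<notin> interior (convex hull (merge I ?J (x, y) ` I))) \<longleftrightarrow>
            y \<in> Pi\<^sub>E ?J (\<lambda>_. - ?C)"
          using y im[of I] by (auto simp: space_PiM PiE_iff merge_def)
        then show "indicator ?E (merge I ?J (x, y)) =
            indicator {x. indexed_convex_position I x} x * (indicator (Pi\<^sub>E ?J (\<lambda>_. - ?C)) y :: ennreal)"
          by (simp add: indicator_def pos)
      qed
      also have "\<dots> = indicator {x. indexed_convex_position I x} x * emeasure (Pi\<^sub>M ?J (\<lambda>_. U)) (Pi\<^sub>E ?J (\<lambda>_. - ?C))"
        using I by (intro nn_integral_cmult_indicator sets_PiM_I_finite) auto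
      also have "emeasure (Pi\<^sub>M ?J (\<lambda>_. U)) (Pi\<^sub>E ?J (\<lambda>_. - ?C)) = (\<Prod>l\<in>?J. emeasure U (- ?C))"
        using I by (intro PU.emeasure_PiM) auto
      also have "\<dots> = ennreal ((1 - hull_area I x) ^ card ?J)"
      proof -
        have "emeasure U (- ?C) = ennreal (1 - hull_area I x)"
          using elim I(1) by (intro emeasure_U_compl_interior_hull) auto
        moreover have "0 \<le> 1 - hull_area I x"
          using hull_area_le_1[OF I(1), of x] elim by simp
        ultimately show ?thesis by (simp add: ennreal_power)
      qed
      finally show ?case by (simp add: position_weight_def)
    qed
  qed
  finally show ?thesis .
qed

text \<open>The points are independent and identically distributed, so only the size of the index
  set matters. This replaces every \<open>k\<close>-subset by \<open>{..<k}\<close>.\<close>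

lemma nn_integral_position_weight_reindex:
  assumes f: "bij_betw f I' I" and I: "finite I"
  shows "(\<integral>\<^sup>+x. position_weight I m x \<partial>Pi\<^sub>M I (\<lambda>_. U)) = (\<integral>\<^sup>+x. position_weight I' m x \<partial>Pi\<^sub>M I' (\<lambda>_. U))"
proof -
  have I': "finite I'" and im: "f ` I' = I" and inj: "inj_on f I'"
    using f I by (auto simp: bij_betw_finite bij_betw_def)
  let ?T = "\<lambda>x. \<lambda>n\<in>I'. (x (f n) :: real^2)"
  have T: "?T \<in> measurable (Pi\<^sub>M I (\<lambda>_. U)) (Pi\<^sub>M I' (\<lambda>_. U))"
    using im by (intro measurable_restrict measurable_component_singleton) auto
  have "(\<integral>\<^sup>+x. position_weight I' m x \<partial>Pi\<^sub>M I' (\<lambda>_. U)) =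
      (\<integral>\<^sup>+x. position_weight I' m x \<partial>distr (Pi\<^sub>M I (\<lambda>_. U)) (Pi\<^sub>M I' (\<lambda>_. U)) ?T)"
    using distr_PiM_reindex[of I "\<lambda>_. U" f I', OF prob_space_U inj] im by auto
  also have "\<dots> = (\<integral>\<^sup>+x. position_weight I' m (?T x) \<partial>Pi\<^sub>M I (\<lambda>_. U))"
    using measurable_position_weight[OF I' measurable_PiM_component] by (intro nn_integral_distr T) auto
  also have "\<dots> = (\<integral>\<^sup>+x. position_weight I m x \<partial>Pi\<^sub>M I (\<lambda>_. U))"
  proof (rule nn_integral_cong)
    fix x
    have im': "?T x ` J = x ` f ` J" if "J \<subseteq> I'" for J using that by (force simp: image_image)
    have diff: "f ` (I' - {n}) = I - {f n}" if "n \<in> I'" for n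
      using inj_on_image_set_diff[OF inj, of I' "{n}"] that im by simp
    have "indexed_convex_position I' (?T x) \<longleftrightarrow>
        (\<forall>n\<in>I'. x (f n) \<notin> convex hull (x ` (I - {f n})))"
      unfolding indexed_convex_position_def
    proof (intro ball_cong refl)
      fix n assume n: "n \<in> I'"
      show "?T x n \<notin> convex hull (?T x ` (I' - {n})) \<longleftrightarrow> x (f n) \<notin> convex hull (x ` (I - {f n}))"
        unfolding im'[OF Diff_subset] diff[OF n] using n by simp
    qed
    also have "\<dots> \<longleftrightarrow> indexed_convex_position I x"
      unfolding indexed_convex_position_def using im by blast
    finally show "position_weight I' m (?T x) = position_weight I m x"
      unfolding position_weight_def hull_area_def im'[OF order_refl] im by (simp add: indicator_def)
  qed
  finally show ?thesis by simp
qed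

text \<open>Linearity over the \<open>k\<close>-subsets of indices, then symmetry: all of them
  contribute the same integral.\<close>

lemma EH_eq:
  assumes n: "k \<le> n"
  shows "EH K k n = enn2real (of_nat (n choose k) *
    (\<integral>\<^sup>+x. position_weight {..<k} (n - k) x \<partial>Pi\<^sub>M {..<k} (\<lambda>_. U)))"
proof -
  let ?N = "{..<n}"
  let ?M = "Pi\<^sub>M ?N (\<lambda>_. U)"
  let ?S = "{I. I \<subseteq> ?N \<and> card I = k}"
  let ?E = "\<lambda>I. {x. first_occurrences I x \<and> hole_event ?N I x}"
  have S: "finite ?S" by simp
  have pred: "Measurable.pred ?M (\<lambda>x. first_occurrences I x \<and> hole_event ?N I x)" if "I \<subseteq> ?N" for I
    using that by (intro pred_intros_logic pred_first_occurrences pred_hole_event measurable_PiM_component) auto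
  have ind[measurable]: "(indicator (?E I) :: _ \<Rightarrow> ennreal) \<in> borel_measurable ?M"
    "(indicator (?E I) :: _ \<Rightarrow> real) \<in> borel_measurable ?M" if "I \<in> ?S" for I
    using pred[of I] that unfolding indicator_def by auto
  have num: "real (num_holes k (x ` ?N)) = (\<Sum>I\<in>?S. indicator (?E I) x)" for x
  proof -
    have "(\<Sum>I\<in>?S. indicator (?E I) x :: real) = (\<Sum>I\<in>?S. if first_occurrences I x \<and> hole_event ?N I x then 1 else 0)"
      by (intro sum.cong) (auto simp: indicator_def)
    also have "\<dots> = real (card (?S \<inter> {I. first_occurrences I x \<and> hole_event ?N I x}))"
      using S by (simp add: sum.If_cases)
    also have "?S \<inter> {I. first_occurrences I x \<and> hole_event ?N I x} =
        {I. I \<subseteq> ?N \<and> card I = k \<and> first_occurrences I x \<and> hole_event ?N I x}" by auto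
    finally show ?thesis by (simp add: num_holes_eq_card)
  qed
  have "EH K k n = enn2real (\<integral>\<^sup>+x. ennreal (\<Sum>I\<in>?S. indicator (?E I) x) \<partial>?M)"
    unfolding EH_def num
    by (intro integral_eq_nn_integral borel_measurable_sum ind) (auto intro!: sum_nonneg)
  also have "(\<integral>\<^sup>+x. ennreal (\<Sum>I\<in>?S. indicator (?E I) x) \<partial>?M) =
      (\<integral>\<^sup>+x. (\<Sum>I\<in>?S. indicator (?E I) x) \<partial>?M)"
    by (intro nn_integral_cong) (simp add: sum_ennreal[symmetric] ennreal_indicator)
  also have "\<dots> = (\<Sum>I\<in>?S. \<integral>\<^sup>+x. indicator (?E I) x \<partial>?M)"
    by (intro nn_integral_sum ind)
  also have "\<dots> = (\<Sum>I\<in>?S. \<integral>\<^sup>+x. position_weight {..<k} (n - k) x \<partial>Pi\<^sub>M {..<k} (\<lambda>_. U))"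
  proof (rule sum.cong[OF refl])
    fix I assume "I \<in> ?S"
    then have I: "I \<subseteq> ?N" "card I = k" "finite I" using finite_subset by auto
    have "(\<integral>\<^sup>+x. indicator (?E I) x \<partial>?M) =
        (\<integral>\<^sup>+x. indicator {x. indexed_convex_position I x \<and>
           (\<forall>l\<in>?N - I. x l \<notin> interior (convex hull (x ` I)))} x \<partial>?M)"
    proof (rule nn_integral_cong_AE)
      \<comment> \<open>Almost surely the points are distinct and in general position, so these
        conditions drop out. Points indexed by \<open>I\<close> are never interior to the hull when
        in convex position, so emptiness concerns only the other points.\<close>
      show "AE x in ?M. indicator (?E I) x = (indicator {x. indexed_convex_position I x \<and>
           (\<forall>l\<in>?N - I. x l \<notin> interior (convex hull (x ` I)))} x :: ennreal)"
        using AE_distinct_first_coordinates[OF finite_lessThan] AE_general_position[OF finite_lessThan]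
      proof eventually_elim
        case (elim x)
        have first: "first_occurrences I x"
          unfolding first_occurrences_def
        proof (intro ballI allI impI notI)
          fix i j assume "i \<in> I" "j < i" "x j = x i"
          then show False using inj_onD[OF elim(1), of j i] I(1) by auto
        qed
        have "x l \<notin> interior (convex hull (x ` I))" if "indexed_convex_position I x" "l \<in> I" for l
          using that I(3) by (intro convex_position_notin_interior) (auto simp: indexed_convex_position_iff)
        then have "hole_event ?N I x \<longleftrightarrow> indexed_convex_position I x \<and>
           (\<forall>l\<in>?N - I. x l \<notin> interior (convex hull (x ` I)))"
          using elim(2) unfolding hole_event_def by blast
        then show ?case using first by (simp add: indicator_def)
      qed
    qed
    also have "\<dots> = (\<integral>\<^sup>+x. position_weight I (n - k) x \<partial>Pi\<^sub>M I (\<lambda>_. U))"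
      using nn_integral_empty_position[OF finite_lessThan I(1)] I by (simp add: card_Diff_subset)
    also obtain f where "bij_betw f {..<k} I"
      using I finite_same_card_bij[of "{..<k}" I] by auto
    then have "(\<integral>\<^sup>+x. position_weight I (n - k) x \<partial>Pi\<^sub>M I (\<lambda>_. U)) =
        (\<integral>\<^sup>+x. position_weight {..<k} (n - k) x \<partial>Pi\<^sub>M {..<k} (\<lambda>_. U))"
      using I(3) by (rule nn_integral_position_weight_reindex)
    finally show "(\<integral>\<^sup>+x. indicator (?E I) x \<partial>?M) =
        (\<integral>\<^sup>+x. position_weight {..<k} (n - k) x \<partial>Pi\<^sub>M {..<k} (\<lambda>_. U))" .
  qed
  also have "\<dots> = of_nat (n choose k) * (\<integral>\<^sup>+x. position_weight {..<k} (n - k) x \<partial>Pi\<^sub>M {..<k} (\<lambda>_. U))"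
    using n_subsets[of ?N k] by simp
  finally show ?thesis .
qed

text \<open>Almost surely exactly one pair spans the tuple, so the indicators of spanning sum to one
  over the pairs.\<close>

lemma nn_integral_position_weight_split:
  fixes k :: nat
  assumes k: "k \<ge> 2"
  shows "(\<integral>\<^sup>+x. position_weight {..<k} m x \<partial>Pi\<^sub>M {..<k} (\<lambda>_. U)) =
    (\<Sum>(i, j)\<in>{(i, j). i < j \<and> j < k}. \<integral>\<^sup>+x. hole_weight {..<k} i j m x \<partial>Pi\<^sub>M {..<k} (\<lambda>_. U))"
proof -
  let ?P = "{(i, j). i < j \<and> j < k}"
  have P: "finite ?P" by (rule finite_subset[of _ "{..<k} \<times> {..<k}"]) (auto intro: less_trans)
  have "(\<integral>\<^sup>+x. position_weight {..<k} m x \<partial>Pi\<^sub>M {..<k} (\<lambda>_. U)) =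
      (\<integral>\<^sup>+x. (\<Sum>p\<in>?P. hole_weight {..<k} (fst p) (snd p) m x) \<partial>Pi\<^sub>M {..<k} (\<lambda>_. U))"
  proof (rule nn_integral_cong_AE)
    show "AE x in Pi\<^sub>M {..<k} (\<lambda>_. U). position_weight {..<k} m x =
        (\<Sum>p\<in>?P. hole_weight {..<k} (fst p) (snd p) m x)"
      using AE_distinct_first_coordinates[OF finite_lessThan]
    proof eventually_elim
      case (elim x)
      have "(\<Sum>p\<in>?P. hole_weight {..<k} (fst p) (snd p) m x) =
          (\<Sum>p\<in>?P. if spans {..<k} (fst p) (snd p) x then position_weight {..<k} m x else 0)"
        by (intro sum.cong) (auto simp: hole_weight_def position_weight_def indicator_def)
      also have "\<dots> = of_nat (card (?P \<inter> {p. spans {..<k} (fst p) (snd p) x})) * position_weight {..<k} m x"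
        using P by (simp add: sum.If_cases)
      also have "?P \<inter> {p. spans {..<k} (fst p) (snd p) x} = {(i, j). i < j \<and> j < k \<and> spans {..<k} i j x}"
        by auto
      finally show ?case by (simp add: ex1_spanning_pair[OF k elim])
    qed
  qed
  also have "\<dots> = (\<Sum>p\<in>?P. \<integral>\<^sup>+x. hole_weight {..<k} (fst p) (snd p) m x \<partial>Pi\<^sub>M {..<k} (\<lambda>_. U))"
    by (intro nn_integral_sum measurable_hole_weight measurable_PiM_component) auto
  finally show ?thesis by (simp add: case_prod_beta)
qed

text \<open>The factor \<open>1 / n ^ 2\<close> is split as \<open>n ^ (k - 2) / n ^ k\<close>. The
  binomial coefficient over \<open>n ^ k\<close> tends to \<open>1 / fact k\<close>, and
  \<open>n ^ (k - 2)\<close> is the scaling under which the integral for each of the finitely many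
  pairs converges.\<close>

lemma tendsto_EH:
  assumes k: "k \<ge> 2"
  shows "(\<lambda>n. EH K k n / (real n)\<^sup>2) \<longlonglongrightarrow>
    enn2real (\<Sum>(i, j)\<in>{(i, j). i < j \<and> j < k}. pair_limit {..<k} i j) / fact k"
proof -
  let ?P = "{(i, j). i < j \<and> j < k}"
  let ?L = "\<Sum>(i, j)\<in>?P. pair_limit {..<k} i j"
  define Q where "Q n = (\<integral>\<^sup>+x. position_weight {..<k} (n - k) x \<partial>Pi\<^sub>M {..<k} (\<lambda>_. U))" for n
  have P: "finite ?P" by (rule finite_subset[of _ "{..<k} \<times> {..<k}"]) (auto intro: less_trans)
  have pair: "unit_area_pair K {..<k} i j" if "i < j" "j < k" for i j
    using that by unfold_locales auto
  have card: "card ({..<k} - {i, j}) = k - 2" if "i < j" "j < k" for i j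
    using that by (subst card_Diff_subset) auto
  have "(\<lambda>n. \<Sum>(i, j)\<in>?P. ennreal (real n ^ (k - 2)) *
      (\<integral>\<^sup>+x. hole_weight {..<k} i j (n - k) x \<partial>Pi\<^sub>M {..<k} (\<lambda>_. U))) \<longlonglongrightarrow> ?L"
    using unit_area_pair.tendsto_nn_integral_hole_weight[OF pair] card
    by (intro tendsto_sum) auto
  then have "(\<lambda>n. ennreal (real n ^ (k - 2)) * Q n) \<longlonglongrightarrow> ?L"
    unfolding Q_def nn_integral_position_weight_split[OF k]
    by (simp add: sum_distrib_left case_prod_beta)
  \<comment> \<open>Finiteness matters because \<open>enn2real\<close> sends infinity to
    \<open>0\<close> and passes to the limit only at finite values.\<close>
  moreover have "?L < \<infinity>"
    using P unit_area_pair.pair_limit_finite[OF pair] by auto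
  ultimately have "(\<lambda>n. enn2real (ennreal (real n ^ (k - 2)) * Q n)) \<longlonglongrightarrow> enn2real ?L"
    by (intro tendsto_enn2real) auto
  from tendsto_mult[OF binomial_over_power_limit[of k] this]
  have "(\<lambda>n. real (n choose k) / real n ^ k * enn2real (ennreal (real n ^ (k - 2)) * Q n))
     \<longlonglongrightarrow> enn2real ?L / fact k" by simp
  moreover have "eventually (\<lambda>n. real (n choose k) / real n ^ k * enn2real (ennreal (real n ^ (k - 2)) * Q n) =
      EH K k n / (real n)\<^sup>2) sequentially"
    using eventually_ge_at_top[of k]
  proof eventually_elim
    case (elim n)
    then have "n > 0" using k by simp
    have "real n ^ k = (real n)\<^sup>2 * real n ^ (k - 2)"
      using k by (metis le_add_diff_inverse power_add)
    then show ?case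
      using \<open>n > 0\<close> EH_eq[OF elim] by (simp add: Q_def enn2real_mult enn2real_of_nat)
  qed
  ultimately show ?thesis by (rule Lim_transform_eventually)
qed

end

theorem theorem7:
  fixes k :: nat
  assumes "k \<ge> 3"
  shows "\<exists>C::real. \<forall>K. convex_body K \<and> measure lborel K = 1 \<longrightarrow>
           (\<lambda>n. EH K k n / (real n)^2) \<longlonglongrightarrow> C"
  \<comment> \<open>The limit in \<open>tendsto_EH\<close> does not mention \<open>K\<close>, so one
    constant serves all bodies.\<close>
  using unit_area_body.tendsto_EH[OF unit_area_body.intro, of _ k] assms by auto

end
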